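(* Let $\mathscr{V}$ be a variety of universal algebras, let $\mathscr{C}\subseteq\mathscr{V}_{\mathrm{fin}}$ be a class of finite algebras closed under subalgebras and finite products, and let $A,B$ be two topologically finitely generated pro-$\mathscr{C}$ algebras. Then $A\cong B$ (as topological algebras) if and only if, for all (discrete) algebras $C\in\mathscr{C}$, the number of continuous homomorphisms $A\to C$ is the same as the number of continuous homomorphisms $B\to C$.
   Context: $\mathscr{V}_{\mathrm{fin}}$ is the class of finite members of $\mathscr{V}$; $\mathscr{C}$ is regarded as a full subcategory of $\mathscr{V}_{\mathrm{fin}}$. Let $\mathscr{K}_{\mathscr{V}}$ be the category whose objects are the topological $\mathscr{V}$-algebras carrying a compact Hausdorff topology and whose morphisms are the continuous homomorphisms; algebras in $\mathscr{C}$ are viewed as objects of $\mathscr{K}_{\mathscr{V}}$ with the discrete topology. A pro-$\mathscr{C}$ algebra is an object $A\in\mathscr{K}_{\mathscr{V}}$ such that, whenever $f,g\colon B\to A$ are distinct morphisms in $\mathscr{K}_{\mathscr{V}}$, there exists a morphism $h\colon A\to C$ in $\mathscr{K}_{\mathscr{V}}$ with $C\in\mathscr{C}$ and $h\circ f\neq h\circ g$. (The full subcategory of $\mathscr{K}_{\mathscr{V}}$ on the pro-$\mathscr{C}$ algebras is identified with the pro-completion of $\mathscr{C}$.) A topological algebra $A$ is topologically finitely generated if there is a finite subset $S\subseteq A$ such that the subalgebra generated by $S$ is dense in $A$. *)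

theory Defs
  imports "HOL-Analysis.Analysis" "HOL-Library.Equipollence"
begin

section \<open>Universal algebra\<close>

(* Finitary, single-sorted signatures; syms may be empty or infinite. The arity of symbols outside
   syms is irrelevant. *)
record 'f signature =
  syms :: "'f set"
  arity :: "'f \<Rightarrow> nat"

(* An n-ary operation takes an extensional n-tuple, i.e. an element of {..<n} \<rightarrow>\<^sub>E carrier, which is
   also the format of the points of product_topology. Empty carriers are allowed. *)
record ('a, 'f) alg =
  carrier :: "'a set"
  opn :: "'f \<Rightarrow> (nat \<Rightarrow> 'a) \<Rightarrow> 'a"

definition subuniverse :: "'f signature \<Rightarrow> ('a, 'f, 'z) alg_scheme \<Rightarrow> 'a set \<Rightarrow> bool" where
  "subuniverse \<Sigma> A S \<longleftrightarrow> S \<subseteq> carrier A \<and>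
     (\<forall>s\<in>syms \<Sigma>. \<forall>x\<in>{..<arity \<Sigma> s} \<rightarrow>\<^sub>E S. opn A s x \<in> S)"

definition is_algebra :: "'f signature \<Rightarrow> ('a, 'f, 'z) alg_scheme \<Rightarrow> bool" where
  "is_algebra \<Sigma> A \<longleftrightarrow>
     (\<forall>s\<in>syms \<Sigma>. \<forall>x\<in>{..<arity \<Sigma> s} \<rightarrow>\<^sub>E carrier A. opn A s x \<in> carrier A)"

definition prod_alg ::
    "'f signature \<Rightarrow> 'i set \<Rightarrow> ('i \<Rightarrow> ('a, 'f) alg) \<Rightarrow> ('i \<Rightarrow> 'a, 'f) alg" where
  "prod_alg \<Sigma> I F = \<lparr>carrier = (\<Pi>\<^sub>E i\<in>I. carrier (F i)),
     opn = (\<lambda>s x. \<lambda>i\<in>I. opn (F i) s (\<lambda>j\<in>{..<arity \<Sigma> s}. x j i))\<rparr>"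

(* Homomorphisms are extensional, so that distinct elements of homs are distinct as maps on the
   carrier and homs can be counted. *)
definition homs ::
    "'f signature \<Rightarrow> ('a, 'f, 'y) alg_scheme \<Rightarrow> ('b, 'f, 'z) alg_scheme \<Rightarrow> ('a \<Rightarrow> 'b) set" where
  "homs \<Sigma> A B = {h \<in> carrier A \<rightarrow>\<^sub>E carrier B.
     \<forall>s\<in>syms \<Sigma>. \<forall>x\<in>{..<arity \<Sigma> s} \<rightarrow>\<^sub>E carrier A.
       h (opn A s x) = opn B s (\<lambda>i\<in>{..<arity \<Sigma> s}. h (x i))}"

definition iso_alg :: "'f signature \<Rightarrow> ('a, 'f) alg \<Rightarrow> ('b, 'f) alg \<Rightarrow> bool" where
  "iso_alg \<Sigma> A B \<longleftrightarrow> (\<exists>h\<in>homs \<Sigma> A B. bij_betw h (carrier A) (carrier B))"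

datatype 'f trm = Var nat | App 'f "'f trm list"

fun wf_trm :: "'f signature \<Rightarrow> 'f trm \<Rightarrow> bool" where
  "wf_trm \<Sigma> (Var n) \<longleftrightarrow> True"
| "wf_trm \<Sigma> (App s ts) \<longleftrightarrow> s \<in> syms \<Sigma> \<and> length ts = arity \<Sigma> s \<and> (\<forall>t\<in>set ts. wf_trm \<Sigma> t)"

primrec eval :: "('a, 'f, 'z) alg_scheme \<Rightarrow> (nat \<Rightarrow> 'a) \<Rightarrow> 'f trm \<Rightarrow> 'a" where
  "eval A v (Var n) = v n"
| "eval A v (App s ts) = opn A s (\<lambda>i\<in>{..<length ts}. map (eval A v) ts ! i)"

definition equations :: "'f signature \<Rightarrow> ('f trm \<times> 'f trm) set" where
  "equations \<Sigma> = {(t, u). wf_trm \<Sigma> t \<and> wf_trm \<Sigma> u}"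

(* The variety axiomatized by the set E of equations, at an arbitrary carrier type. *)
definition variety ::
    "'f signature \<Rightarrow> ('f trm \<times> 'f trm) set \<Rightarrow> ('a, 'f, 'z) alg_scheme set" where
  "variety \<Sigma> E = {A. is_algebra \<Sigma> A \<and>
     (\<forall>(t, u)\<in>E. \<forall>v. range v \<subseteq> carrier A \<longrightarrow> eval A v t = eval A v u)}"

definition variety_fin ::
    "'f signature \<Rightarrow> ('f trm \<times> 'f trm) set \<Rightarrow> ('a, 'f) alg set" where
  "variety_fin \<Sigma> E = {A \<in> variety \<Sigma> E. finite (carrier A)}"

(* A class of finite algebras is represented by a set of algebras over one carrier type; over any
   infinite type, this covers every class of finite algebras up to isomorphism. Closure conditions
   are accordingly up to isomorphism. *)
definition closed_subalgebras :: "'f signature \<Rightarrow> ('c, 'f) alg set \<Rightarrow> bool" where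
  "closed_subalgebras \<Sigma> \<C> \<longleftrightarrow>
     (\<forall>C\<in>\<C>. \<forall>S. subuniverse \<Sigma> C S \<longrightarrow> (\<exists>D\<in>\<C>. iso_alg \<Sigma> D (C\<lparr>carrier := S\<rparr>)))"

(* The empty product, i.e. the one-element algebra, is included. *)
definition closed_finite_products :: "'f signature \<Rightarrow> ('c, 'f) alg set \<Rightarrow> bool" where
  "closed_finite_products \<Sigma> \<C> \<longleftrightarrow>
     (\<forall>(I :: nat set) F. finite I \<and> (\<forall>i\<in>I. F i \<in> \<C>) \<longrightarrow>
        (\<exists>D\<in>\<C>. iso_alg \<Sigma> D (prod_alg \<Sigma> I F)))"


section \<open>Topological algebras\<close>

record ('a, 'f) top_alg = "('a, 'f) alg" +
  topo :: "'a topology"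

definition topological_algebra :: "'f signature \<Rightarrow> ('a, 'f) top_alg \<Rightarrow> bool" where
  "topological_algebra \<Sigma> A \<longleftrightarrow> is_algebra \<Sigma> A \<and> topspace (topo A) = carrier A \<and>
     (\<forall>s\<in>syms \<Sigma>.
        continuous_map (product_topology (\<lambda>_. topo A) {..<arity \<Sigma> s}) (topo A) (opn A s))"

definition choms ::
    "'f signature \<Rightarrow> ('a, 'f) top_alg \<Rightarrow> ('b, 'f) top_alg \<Rightarrow> ('a \<Rightarrow> 'b) set" where
  "choms \<Sigma> A B = {h \<in> homs \<Sigma> A B. continuous_map (topo A) (topo B) h}"

definition iso_top_alg :: "'f signature \<Rightarrow> ('a, 'f) top_alg \<Rightarrow> ('b, 'f) top_alg \<Rightarrow> bool" where
  "iso_top_alg \<Sigma> A B \<longleftrightarrow> (\<exists>h\<in>homs \<Sigma> A B. homeomorphic_map (topo A) (topo B) h)"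

definition discrete_alg :: "('a, 'f) alg \<Rightarrow> ('a, 'f) top_alg" where
  "discrete_alg A = alg.extend A (top_alg.fields (discrete_topology (carrier A)))"

(* The objects of the category of compact Hausdorff algebras; its morphisms are given by choms. *)
definition compact_algebras ::
    "'f signature \<Rightarrow> ('f trm \<times> 'f trm) set \<Rightarrow> ('a, 'f) top_alg set" where
  "compact_algebras \<Sigma> E = {A. A \<in> variety \<Sigma> E \<and> topological_algebra \<Sigma> A \<and>
     compact_space (topo A) \<and> Hausdorff_space (topo A)}"

(* The test objects B should range over compact Hausdorff algebras of arbitrary carrier type, which
   a definition cannot quantify over. The type 'a \<times> 'a suffices: see pro_algebras_cancel. *)
definition pro_algebras ::
    "'f signature \<Rightarrow> ('f trm \<times> 'f trm) set \<Rightarrow> ('c, 'f) alg set \<Rightarrow> ('a, 'f) top_alg set" where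
  "pro_algebras \<Sigma> E \<C> = {A \<in> compact_algebras \<Sigma> E.
     \<forall>B :: ('a \<times> 'a, 'f) top_alg. B \<in> compact_algebras \<Sigma> E \<longrightarrow>
       (\<forall>f\<in>choms \<Sigma> B A. \<forall>g\<in>choms \<Sigma> B A. f \<noteq> g \<longrightarrow>
          (\<exists>C\<in>\<C>. \<exists>h\<in>choms \<Sigma> A (discrete_alg C).
             compose (carrier B) h f \<noteq> compose (carrier B) h g))}"

definition topologically_fg :: "'f signature \<Rightarrow> ('a, 'f) top_alg \<Rightarrow> bool" where
  "topologically_fg \<Sigma> A \<longleftrightarrow> (\<exists>S. finite S \<and> S \<subseteq> carrier A \<and>
     topo A closure_of (subuniverse \<Sigma> A hull S) = carrier A)"


section \<open>Adequacy of the test objects\<close>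

lemma discrete_alg_simps [simp]:
  "carrier (discrete_alg A) = carrier A" "opn (discrete_alg A) = opn A"
  "topo (discrete_alg A) = discrete_topology (carrier A)"
  by (simp_all add: discrete_alg_def alg.defs top_alg.defs)

lemma eval_discrete_alg: "eval (discrete_alg A) v t = eval A v t"
  by (induction t) (auto intro!: arg_cong[where f = "opn A _"] restrict_ext)

lemma discrete_compact_algebra:
  assumes "A \<in> variety_fin \<Sigma> E"
  shows "discrete_alg A \<in> compact_algebras \<Sigma> E"
proof -
  have alg: "is_algebra \<Sigma> (discrete_alg A)"
    using assms by (auto simp: variety_fin_def variety_def is_algebra_def)
  have disc: "product_topology (\<lambda>_. discrete_topology (carrier A)) {..<n}
      = discrete_topology ({..<n} \<rightarrow>\<^sub>E carrier A)" for n :: nat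
  proof (rule sym, subst discrete_topology_unique, intro conjI ballI)
    fix x assume x: "x \<in> {..<n} \<rightarrow>\<^sub>E carrier A"
    let ?X = "\<lambda>i. if i < n then {x i} else carrier A"
    have "openin (product_topology (\<lambda>_. discrete_topology (carrier A)) {..<n})
        (\<Pi>\<^sub>E i\<in>{..<n}. ?X i)"
    proof (rule product_topology_basis)
      have "{i. ?X i \<noteq> topspace (discrete_topology (carrier A))} \<subseteq> {..<n}" by auto
      then show "finite {i. ?X i \<noteq> topspace (discrete_topology (carrier A))}"
        by (rule finite_subset) simp
    qed (use x in auto)
    moreover have "(\<Pi>\<^sub>E i\<in>{..<n}. ?X i) = {x}"
      using x by (auto simp: PiE_iff extensional_def intro!: extensionalityI[of _ "{..<n}"])
    ultimately show "openin (product_topology (\<lambda>_. discrete_topology (carrier A)) {..<n}) {x}"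
      by simp
  qed simp
  show ?thesis
    using assms alg
    by (auto simp: compact_algebras_def variety_fin_def variety_def topological_algebra_def
        eval_discrete_alg disc is_algebra_def compact_space_discrete_topology)
qed

lemma eval_closed:
  assumes "is_algebra \<Sigma> A" "range v \<subseteq> carrier A"
  shows "wf_trm \<Sigma> t \<Longrightarrow> eval A v t \<in> carrier A"
proof (induction t)
  case (Var n)
  then show ?case using assms by auto
next
  case (App s ts)
  have "(\<lambda>i\<in>{..<length ts}. map (eval A v) ts ! i) \<in> {..<arity \<Sigma> s} \<rightarrow>\<^sub>E carrier A"
    using App by (auto simp: PiE_iff)
  then show ?case using App.prems assms(1) by (auto simp: is_algebra_def)
qed

lemma eval_hom:
  assumes "is_algebra \<Sigma> A" "range v \<subseteq> carrier A"
    and hom: "\<And>s x. \<lbrakk>s \<in> syms \<Sigma>; x \<in> {..<arity \<Sigma> s} \<rightarrow>\<^sub>E carrier A\<rbrakk>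
       \<Longrightarrow> h (opn A s x) = opn B s (\<lambda>i\<in>{..<arity \<Sigma> s}. h (x i))"
  shows "wf_trm \<Sigma> t \<Longrightarrow> h (eval A v t) = eval B (h \<circ> v) t"
proof (induction t)
  case (Var n)
  then show ?case by simp
next
  case (App s ts)
  have "(\<lambda>i\<in>{..<length ts}. map (eval A v) ts ! i) \<in> {..<arity \<Sigma> s} \<rightarrow>\<^sub>E carrier A"
    using App.prems eval_closed[OF assms(1,2)] by (auto simp: PiE_iff)
  from hom[OF _ this] show ?case
    using App by (auto intro!: arg_cong[where f = "opn B s"] restrict_ext)
qed

(* Any pair f, g factors through its image in A \<times> A. *)
lemma pro_algebras_cancel:
  fixes A :: "('a, 'f) top_alg" and B :: "('b, 'f) top_alg"
  assumes E: "E \<subseteq> equations \<Sigma>" and A: "A \<in> pro_algebras \<Sigma> E \<C>"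
    and B: "B \<in> compact_algebras \<Sigma> E"
    and f: "f \<in> choms \<Sigma> B A" and g: "g \<in> choms \<Sigma> B A" and "f \<noteq> g"
  shows "\<exists>C\<in>\<C>. \<exists>h\<in>choms \<Sigma> A (discrete_alg C). compose (carrier B) h f \<noteq> compose (carrier B) h g"
proof -
  define q where "q = (\<lambda>x. (f x, g x))"
  define P where "P = q ` carrier B"
  define B' :: "('a \<times> 'a, 'f) top_alg" where "B' = \<lparr>carrier = P,
    opn = (\<lambda>s x. (opn A s (\<lambda>i\<in>{..<arity \<Sigma> s}. fst (x i)), opn A s (\<lambda>i\<in>{..<arity \<Sigma> s}. snd (x i)))),
    topo = subtopology (prod_topology (topo A) (topo A)) P\<rparr>"
  have KA: "A \<in> compact_algebras \<Sigma> E" using A by (simp add: pro_algebras_def)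
  have tA: "topspace (topo A) = carrier A" and tB: "topspace (topo B) = carrier B"
    using KA B by (auto simp: compact_algebras_def topological_algebra_def)
  have algB: "is_algebra \<Sigma> B" using B by (auto simp: compact_algebras_def variety_def)
  have fc: "f x \<in> carrier A" "g x \<in> carrier A" if "x \<in> carrier B" for x
    using f g that by (auto simp: choms_def homs_def)
  have PA: "P \<subseteq> carrier A \<times> carrier A" using fc by (auto simp: P_def q_def)
  have cB': "carrier B' = P" by (simp add: B'_def)
  have tB': "topspace (topo B') = P" using PA by (auto simp: B'_def tA)
  have qhom: "q (opn B s x) = opn B' s (\<lambda>i\<in>{..<arity \<Sigma> s}. q (x i))"
    if "s \<in> syms \<Sigma>" "x \<in> {..<arity \<Sigma> s} \<rightarrow>\<^sub>E carrier B" for s x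
  proof -
    have "f (opn B s x) = opn A s (\<lambda>i\<in>{..<arity \<Sigma> s}. f (x i))"
      "g (opn B s x) = opn A s (\<lambda>i\<in>{..<arity \<Sigma> s}. g (x i))"
      using f g that by (auto simp: choms_def homs_def)
    then show ?thesis by (simp add: q_def B'_def cong: restrict_cong)
  qed
  define r where "r = inv_into (carrier B) q"
  have r: "r p \<in> carrier B" "q (r p) = p" if "p \<in> P" for p
    using that by (auto simp: r_def P_def inv_into_into f_inv_into_f)
  have algB': "is_algebra \<Sigma> B'"
    unfolding is_algebra_def
  proof (intro ballI)
    fix s x assume s: "s \<in> syms \<Sigma>" and x: "x \<in> {..<arity \<Sigma> s} \<rightarrow>\<^sub>E carrier B'"
    let ?y = "\<lambda>i\<in>{..<arity \<Sigma> s}. r (x i)"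
    have xP: "x i \<in> P" if "i < arity \<Sigma> s" for i using x that by (auto simp: B'_def)
    have y: "?y \<in> {..<arity \<Sigma> s} \<rightarrow>\<^sub>E carrier B" using xP r by auto
    have "(\<lambda>i\<in>{..<arity \<Sigma> s}. q (?y i)) = x"
      using x xP r by (intro extensionalityI[of _ "{..<arity \<Sigma> s}"]) (auto simp: PiE_def)
    with qhom[OF s y] have "opn B' s x = q (opn B s ?y)" by simp
    moreover have "opn B s ?y \<in> carrier B" using algB s y by (auto simp: is_algebra_def)
    ultimately show "opn B' s x \<in> carrier B'" by (auto simp: B'_def P_def)
  qed
  have varB': "B' \<in> variety \<Sigma> E"
  proof -
    have "eval B' v t = eval B' v u" if tu: "(t, u) \<in> E" and v: "range v \<subseteq> P" for t u v
    proof -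
      have w: "range (r \<circ> v) \<subseteq> carrier B" and qv: "q \<circ> (r \<circ> v) = v"
        using v r by (auto simp: fun_eq_iff image_subset_iff)
      have "eval B (r \<circ> v) t = eval B (r \<circ> v) u"
        using B tu w by (auto simp: compact_algebras_def variety_def)
      moreover have "wf_trm \<Sigma> t" "wf_trm \<Sigma> u" using E tu by (auto simp: equations_def)
      ultimately show ?thesis
        using eval_hom[OF algB w qhom, of t] eval_hom[OF algB w qhom, of u] qv by simp
    qed
    with algB' show ?thesis by (auto simp: variety_def B'_def)
  qed
  have contq: "continuous_map (topo B) (topo B') q"
    using f g by (auto simp: B'_def P_def q_def choms_def continuous_map_in_subtopology
        continuous_map_pairwise o_def tB)
  have compB': "compact_space (topo B')"
  proof -
    have "compactin (topo B') (q ` topspace (topo B))"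
      using B contq by (intro image_compactin) (auto simp: compact_algebras_def compact_space_def)
    then show ?thesis using tB tB' by (simp add: compact_space_def P_def)
  qed
  have hausB': "Hausdorff_space (topo B')"
    using KA by (auto simp: B'_def compact_algebras_def Hausdorff_space_prod_topology
        intro!: Hausdorff_space_subtopology)
  have contB': "continuous_map (product_topology (\<lambda>_. topo B') {..<arity \<Sigma> s}) (topo B') (opn B' s)"
    if s: "s \<in> syms \<Sigma>" for s
  proof -
    let ?T = "product_topology (\<lambda>_. topo B') {..<arity \<Sigma> s}"
    let ?TA = "product_topology (\<lambda>_. topo A) {..<arity \<Sigma> s}"
    have cA: "continuous_map ?TA (topo A) (opn A s)"
      using KA s by (auto simp: compact_algebras_def topological_algebra_def)
    have prj: "continuous_map (topo B') (topo A) fst" "continuous_map (topo B') (topo A) snd"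
      by (auto simp: B'_def intro!: continuous_map_from_subtopology
          continuous_map_fst continuous_map_snd)
    have c: "continuous_map ?T (topo A) (\<lambda>x. opn A s (\<lambda>i\<in>{..<arity \<Sigma> s}. p (x i)))"
      if p: "continuous_map (topo B') (topo A) p" for p
    proof -
      have "continuous_map ?T (topo A) (\<lambda>x. p (x i))" if "i \<in> {..<arity \<Sigma> s}" for i
        using continuous_map_compose[OF continuous_map_product_projection[OF that] p]
        by (simp add: o_def)
      then have "continuous_map ?T ?TA (\<lambda>x. \<lambda>i\<in>{..<arity \<Sigma> s}. p (x i))"
        by (subst continuous_map_componentwise) (auto cong: restrict_cong)
      from continuous_map_compose[OF this cA] show ?thesis by (simp add: o_def)
    qed
    have "continuous_map ?T (prod_topology (topo A) (topo A)) (opn B' s)"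
      using c[OF prj(1)] c[OF prj(2)] by (simp add: B'_def continuous_map_pairwise o_def)
    moreover have "opn B' s \<in> topspace ?T \<rightarrow> P"
      using algB' s tB' by (auto simp: is_algebra_def B'_def)
    ultimately show ?thesis by (simp add: B'_def continuous_map_in_subtopology)
  qed
  have KB': "B' \<in> compact_algebras \<Sigma> E"
    unfolding compact_algebras_def topological_algebra_def mem_Collect_eq
    using varB' algB' tB' contB' compB' hausB' cB' by (intro conjI ballI) simp_all
  have prjm: "restrict p P \<in> choms \<Sigma> B' A" if "p = fst \<or> p = snd" for p
  proof -
    have "continuous_map (topo B') (topo A) p"
      using that by (auto simp: B'_def intro!: continuous_map_from_subtopology
          continuous_map_fst continuous_map_snd)
    then have "continuous_map (topo B') (topo A) (restrict p P)"
      by (rule continuous_map_eq) (simp add: tB')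
    moreover have "restrict p P \<in> homs \<Sigma> B' A"
    proof -
      have "restrict p P (opn B' s x) = opn A s (\<lambda>i\<in>{..<arity \<Sigma> s}. restrict p P (x i))"
        if s: "s \<in> syms \<Sigma>" and x: "x \<in> {..<arity \<Sigma> s} \<rightarrow>\<^sub>E carrier B'" for s x
      proof -
        have "opn B' s x \<in> P" using algB' s x by (auto simp: is_algebra_def B'_def)
        moreover have "(\<lambda>i\<in>{..<arity \<Sigma> s}. restrict p P (x i)) = (\<lambda>i\<in>{..<arity \<Sigma> s}. p (x i))"
          using x by (intro restrict_ext) (auto simp: B'_def PiE_iff)
        ultimately show ?thesis using \<open>p = fst \<or> p = snd\<close> by (auto simp: B'_def)
      qed
      moreover have "restrict p P \<in> carrier B' \<rightarrow>\<^sub>E carrier A"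
        using PA that by (auto simp: B'_def)
      ultimately show ?thesis by (auto simp: homs_def)
    qed
    ultimately show ?thesis by (simp add: choms_def)
  qed
  obtain x where x: "x \<in> carrier B" "f x \<noteq> g x"
    using f g \<open>f \<noteq> g\<close> PiE_ext[of f "carrier B" "\<lambda>_. carrier A" g]
    by (auto simp: choms_def homs_def)
  then have "restrict fst P (q x) \<noteq> restrict snd P (q x)"
    by (auto simp: P_def q_def)
  then have "restrict fst P \<noteq> restrict snd P" by metis
  moreover have "\<forall>f\<in>choms \<Sigma> B' A. \<forall>g\<in>choms \<Sigma> B' A. f \<noteq> g \<longrightarrow>
      (\<exists>C\<in>\<C>. \<exists>h\<in>choms \<Sigma> A (discrete_alg C).
         compose (carrier B') h f \<noteq> compose (carrier B') h g)"
    using A KB' by (simp add: pro_algebras_def)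
  ultimately obtain C h where C: "C \<in> \<C>" and h: "h \<in> choms \<Sigma> A (discrete_alg C)"
    and ne: "compose (carrier B') h (restrict fst P) \<noteq> compose (carrier B') h (restrict snd P)"
    using prjm[of fst] prjm[of snd] by blast
  have "\<exists>p\<in>P. h (fst p) \<noteq> h (snd p)"
  proof (rule ccontr)
    assume "\<not> ?thesis"
    then have "compose (carrier B') h (restrict fst P) = compose (carrier B') h (restrict snd P)"
      by (auto simp: compose_def B'_def intro!: restrict_ext)
    with ne show False by simp
  qed
  then obtain y where "y \<in> carrier B" "h (f y) \<noteq> h (g y)" by (auto simp: P_def q_def)
  then have "compose (carrier B) h f y \<noteq> compose (carrier B) h g y" by (simp add: compose_def)
  with C h show ?thesis by metis
qed

end

(* By Moebius-style induction over subalgebras, equal numbers of homomorphisms into every C \<in> \<C>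
   give equal numbers of surjections, so A and B have the same quotients in \<C>. A compactness
   argument turns this into an assignment \<Phi> from the homomorphisms h : B \<rightarrow> C, with C ranging over
   \<C>, to homomorphisms A \<rightarrow> C such that every finite family of h's has the same joint image as the
   family of their \<Phi>-images. Compatibility for pairs makes \<Phi> injective, hence bijective on the
   finite sets of homomorphisms into each C. The closed relation {(a, b). \<forall>h. \<Phi> h a = h b} is then
   the graph of an isomorphism: compactness gives totality on both sides, and separation of points
   by maps into \<C> gives uniqueness on both sides. *)
theory Submission
  imports Defs
begin

section \<open>Homomorphisms\<close>

text \<open>Equal counts show only that \<open>A\<close> has a surjection onto a member
  \<open>D\<close> of \<open>\<C>\<close> whenever \<open>B\<close> has one; they do not pair off
  particular surjections. For finitely many homomorphisms out of \<open>B\<close> a choice on the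
  side of \<open>A\<close> is easy, but choices made for different finite families need not agree.
  The remedy is that the admissible choices for a finite family form a closed set in a product of
  finite discrete sets, and that this set shrinks as the family grows. Topological finite generation
  enters as finiteness of the sets of homomorphisms into each \<open>C\<close>. This finiteness
  allows the subtraction of counts, makes the product of these sets compact, and turns an injection
  into a bijection. Equality of joint images is cheap to obtain, since two surjections onto the same
  \<open>D\<close> have the same image, and it is strong enough to make all the equations that tie a
  point of \<open>A\<close> to a point of \<open>B\<close> finitely solvable. As \<open>\<C>\<close>
  is closed only up to isomorphism, an image inside \<open>C\<close> need not be a member itself. It
  is represented by a member \<open>D\<close> with an injective homomorphism into \<open>C\<close>,
  and maps are lifted along it.\<close>

lemma homsD:
  assumes "h \<in> homs \<Sigma> A B"
  shows "h \<in> carrier A \<rightarrow>\<^sub>E carrier B"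
    and "\<lbrakk>s \<in> syms \<Sigma>; x \<in> {..<arity \<Sigma> s} \<rightarrow>\<^sub>E carrier A\<rbrakk>
      \<Longrightarrow> h (opn A s x) = opn B s (\<lambda>i\<in>{..<arity \<Sigma> s}. h (x i))"
  using assms by (auto simp: homs_def)

lemma homs_discrete_alg [simp]:
  "homs \<Sigma> A (discrete_alg C) = homs \<Sigma> A C" "homs \<Sigma> (discrete_alg C) A = homs \<Sigma> C A"
  by (simp_all add: homs_def)

lemma homs_carrier_update:
  "h \<in> homs \<Sigma> D (C\<lparr>carrier := S\<rparr>) \<Longrightarrow> S \<subseteq> carrier C \<Longrightarrow> h \<in> homs \<Sigma> D C"
  by (auto simp: homs_def PiE_iff)

lemma homs_compose:
  assumes A: "is_algebra \<Sigma> A" and f: "f \<in> homs \<Sigma> A B" and g: "g \<in> homs \<Sigma> B C"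
  shows "compose (carrier A) g f \<in> homs \<Sigma> A C"
proof -
  note fD = homsD[OF f] and gD = homsD[OF g]
  have "compose (carrier A) g f (opn A s x) =
      opn C s (\<lambda>i\<in>{..<arity \<Sigma> s}. compose (carrier A) g f (x i))"
    if s: "s \<in> syms \<Sigma>" and x: "x \<in> {..<arity \<Sigma> s} \<rightarrow>\<^sub>E carrier A" for s x
  proof -
    have "opn A s x \<in> carrier A" using A s x by (auto simp: is_algebra_def)
    moreover have "(\<lambda>i\<in>{..<arity \<Sigma> s}. f (x i)) \<in> {..<arity \<Sigma> s} \<rightarrow>\<^sub>E carrier B"
      using fD(1) x by auto
    ultimately show ?thesis
      using fD(2)[OF s x] gD(2)[OF s] x
      by (auto simp: compose_def PiE_iff intro!: arg_cong[where f = "opn C s"] restrict_ext)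
  qed
  moreover have "compose (carrier A) g f \<in> carrier A \<rightarrow>\<^sub>E carrier C"
    using fD(1) gD(1) by (auto simp: compose_def)
  ultimately show ?thesis by (auto simp: homs_def)
qed

text \<open>As \<open>j\<close> is injective, the identities for the lifted map can be checked after
  applying \<open>j\<close>, where they become those of \<open>h\<close>. Here \<open>D\<close>
  stands for a subalgebra of \<open>C\<close> that contains the image of \<open>h\<close>.\<close>

lemma homs_factor:
  assumes A: "is_algebra \<Sigma> A" and D: "is_algebra \<Sigma> D"
    and h: "h \<in> homs \<Sigma> A C" and j: "j \<in> homs \<Sigma> D C"
    and inj: "inj_on j (carrier D)" and im: "h ` carrier A \<subseteq> j ` carrier D"
  shows "compose (carrier A) (inv_into (carrier D) j) h \<in> homs \<Sigma> A D"
proof -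
  note hD = homsD[OF h] and jD = homsD[OF j]
  let ?g = "\<lambda>a. inv_into (carrier D) j (h a)"
  have g: "?g a \<in> carrier D" "j (?g a) = h a" if "a \<in> carrier A" for a
    using im that by (auto simp: inv_into_into f_inv_into_f)
  have "?g (opn A s x) = opn D s (\<lambda>i\<in>{..<arity \<Sigma> s}. ?g (x i))"
    if s: "s \<in> syms \<Sigma>" and x: "x \<in> {..<arity \<Sigma> s} \<rightarrow>\<^sub>E carrier A" for s x
  proof -
    let ?y = "\<lambda>i\<in>{..<arity \<Sigma> s}. ?g (x i)"
    have y: "?y \<in> {..<arity \<Sigma> s} \<rightarrow>\<^sub>E carrier D" using g x by auto
    have a: "opn A s x \<in> carrier A" using A s x by (auto simp: is_algebra_def)
    have d: "opn D s ?y \<in> carrier D" using D s y by (auto simp: is_algebra_def)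
    have "j (opn D s ?y) = opn C s (\<lambda>i\<in>{..<arity \<Sigma> s}. h (x i))"
      using jD(2)[OF s y] g x by (auto simp: PiE_iff intro!: arg_cong[where f = "opn C s"] restrict_ext)
    then have "j (?g (opn A s x)) = j (opn D s ?y)"
      using hD(2)[OF s x] g(2)[OF a] by simp
    with inj show ?thesis using a d g(1) by (auto dest: inj_onD)
  qed
  moreover have "opn A s x \<in> carrier A"
    if "s \<in> syms \<Sigma>" "x \<in> {..<arity \<Sigma> s} \<rightarrow>\<^sub>E carrier A" for s x
    using A that by (auto simp: is_algebra_def)
  ultimately show ?thesis
    using g(1) by (auto simp: homs_def compose_def PiE_iff
        intro!: arg_cong[where f = "opn D _"] restrict_ext)
qed

lemma subuniverse_image:
  assumes A: "is_algebra \<Sigma> A" and h: "h \<in> homs \<Sigma> A B"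
  shows "subuniverse \<Sigma> B (h ` carrier A)"
  unfolding subuniverse_def
proof (intro conjI ballI)
  note hD = homsD[OF h]
  show "h ` carrier A \<subseteq> carrier B" using hD(1) by auto
  fix s x assume s: "s \<in> syms \<Sigma>" and x: "x \<in> {..<arity \<Sigma> s} \<rightarrow>\<^sub>E h ` carrier A"
  let ?y = "\<lambda>i\<in>{..<arity \<Sigma> s}. inv_into (carrier A) h (x i)"
  have r: "inv_into (carrier A) h (x i) \<in> carrier A" "h (inv_into (carrier A) h (x i)) = x i"
    if "i < arity \<Sigma> s" for i
  proof -
    have "x i \<in> h ` carrier A" using x that by auto
    then show "inv_into (carrier A) h (x i) \<in> carrier A" "h (inv_into (carrier A) h (x i)) = x i"
      by (simp_all add: inv_into_into f_inv_into_f)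
  qed
  have y: "?y \<in> {..<arity \<Sigma> s} \<rightarrow>\<^sub>E carrier A" using r by auto
  have "(\<lambda>i\<in>{..<arity \<Sigma> s}. h (?y i)) = x"
    using x r by (intro extensionalityI[of _ "{..<arity \<Sigma> s}"]) (auto simp: PiE_def)
  with hD(2)[OF s y] have "opn B s x = h (opn A s ?y)" by simp
  moreover have "opn A s ?y \<in> carrier A" using A s y by (auto simp: is_algebra_def)
  ultimately show "opn B s x \<in> h ` carrier A" by auto
qed

lemma subuniverse_carrier: "is_algebra \<Sigma> A \<Longrightarrow> subuniverse \<Sigma> A (carrier A)"
  by (simp add: subuniverse_def is_algebra_def)

lemma subuniverse_equalizer:
  assumes A: "is_algebra \<Sigma> A" and f: "f \<in> homs \<Sigma> A B" and g: "g \<in> homs \<Sigma> A B"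
  shows "subuniverse \<Sigma> A {a \<in> carrier A. f a = g a}"
  unfolding subuniverse_def
proof (intro conjI ballI)
  fix s x assume s: "s \<in> syms \<Sigma>" and x: "x \<in> {..<arity \<Sigma> s} \<rightarrow>\<^sub>E {a \<in> carrier A. f a = g a}"
  then have x': "x \<in> {..<arity \<Sigma> s} \<rightarrow>\<^sub>E carrier A" by auto
  have "(\<lambda>i\<in>{..<arity \<Sigma> s}. f (x i)) = (\<lambda>i\<in>{..<arity \<Sigma> s}. g (x i))"
    using x by (intro restrict_ext) auto
  then have "f (opn A s x) = g (opn A s x)"
    using homsD(2)[OF f s x'] homsD(2)[OF g s x'] by simp
  moreover have "opn A s x \<in> carrier A" using A s x' by (auto simp: is_algebra_def)
  ultimately show "opn A s x \<in> {a \<in> carrier A. f a = g a}" by simp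
qed auto

section \<open>Products of algebras: projections and tuples\<close>

lemma is_algebra_prod_alg:
  assumes "\<And>i. i \<in> I \<Longrightarrow> is_algebra \<Sigma> (F i)"
  shows "is_algebra \<Sigma> (prod_alg \<Sigma> I F)"
  unfolding is_algebra_def
proof (intro ballI)
  fix s x assume s: "s \<in> syms \<Sigma>" and x: "x \<in> {..<arity \<Sigma> s} \<rightarrow>\<^sub>E carrier (prod_alg \<Sigma> I F)"
  have "(\<lambda>j\<in>{..<arity \<Sigma> s}. x j i) \<in> {..<arity \<Sigma> s} \<rightarrow>\<^sub>E carrier (F i)" if "i \<in> I" for i
    using x that by (auto simp: prod_alg_def PiE_iff)
  then show "opn (prod_alg \<Sigma> I F) s x \<in> carrier (prod_alg \<Sigma> I F)"
    using assms s by (auto simp: prod_alg_def is_algebra_def)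
qed

lemma homs_prod_projection:
  assumes i: "i \<in> I" and alg: "\<And>i. i \<in> I \<Longrightarrow> is_algebra \<Sigma> (F i)"
  shows "(\<lambda>x\<in>carrier (prod_alg \<Sigma> I F). x i) \<in> homs \<Sigma> (prod_alg \<Sigma> I F) (F i)"
proof -
  let ?P = "prod_alg \<Sigma> I F"
  have "opn ?P s x i = opn (F i) s (\<lambda>j\<in>{..<arity \<Sigma> s}. (\<lambda>x\<in>carrier ?P. x i) (x j))"
    if "s \<in> syms \<Sigma>" and x: "x \<in> {..<arity \<Sigma> s} \<rightarrow>\<^sub>E carrier ?P" for s x
  proof -
    have "x j \<in> carrier ?P" if "j < arity \<Sigma> s" for j using x that by auto
    then show ?thesis
      using i by (auto simp: prod_alg_def intro!: arg_cong[where f = "opn (F i) s"] restrict_ext)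
  qed
  moreover have "opn ?P s x \<in> carrier ?P"
    if "s \<in> syms \<Sigma>" "x \<in> {..<arity \<Sigma> s} \<rightarrow>\<^sub>E carrier ?P" for s x
    using is_algebra_prod_alg[of I \<Sigma> F] alg that by (auto simp: is_algebra_def)
  moreover have "(\<lambda>x\<in>carrier ?P. x i) \<in> carrier ?P \<rightarrow>\<^sub>E carrier (F i)"
    using i by (auto simp: prod_alg_def)
  ultimately show ?thesis by (auto simp: homs_def)
qed

lemma homs_prod_tuple:
  assumes A: "is_algebra \<Sigma> A" and h: "\<And>i. i \<in> I \<Longrightarrow> h i \<in> homs \<Sigma> A (F i)"
  shows "(\<lambda>a\<in>carrier A. \<lambda>i\<in>I. h i a) \<in> homs \<Sigma> A (prod_alg \<Sigma> I F)"
proof -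
  let ?H = "\<lambda>a\<in>carrier A. \<lambda>i\<in>I. h i a"
  have "?H (opn A s x) = opn (prod_alg \<Sigma> I F) s (\<lambda>i\<in>{..<arity \<Sigma> s}. ?H (x i))"
    if s: "s \<in> syms \<Sigma>" and x: "x \<in> {..<arity \<Sigma> s} \<rightarrow>\<^sub>E carrier A" for s x
  proof -
    have "opn A s x \<in> carrier A" using A s x by (auto simp: is_algebra_def)
    moreover have "h i (opn A s x) =
        opn (F i) s (\<lambda>j\<in>{..<arity \<Sigma> s}. (\<lambda>i\<in>{..<arity \<Sigma> s}. ?H (x i)) j i)" if i: "i \<in> I" for i
    proof -
      have "(\<lambda>j\<in>{..<arity \<Sigma> s}. (\<lambda>i\<in>{..<arity \<Sigma> s}. ?H (x i)) j i) =
          (\<lambda>j\<in>{..<arity \<Sigma> s}. h i (x j))"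
        using x i by (intro restrict_ext) (auto simp: PiE_iff)
      then show ?thesis using homsD(2)[OF h[OF i] s x] by simp
    qed
    ultimately show ?thesis
      unfolding prod_alg_def by (auto intro!: restrict_ext)
  qed
  moreover have "?H \<in> carrier A \<rightarrow>\<^sub>E carrier (prod_alg \<Sigma> I F)"
    using homsD(1)[OF h] by (auto simp: prod_alg_def PiE_iff)
  ultimately show ?thesis by (auto simp: homs_def)
qed

section \<open>Continuous homomorphisms\<close>

lemma choms_compose:
  assumes "is_algebra \<Sigma> A" "topspace (topo A) = carrier A"
    and f: "f \<in> choms \<Sigma> A B" and g: "g \<in> choms \<Sigma> B C"
  shows "compose (carrier A) g f \<in> choms \<Sigma> A C"
proof -
  have "continuous_map (topo A) (topo C) (g \<circ> f)"
    using f g by (auto simp: choms_def intro: continuous_map_compose)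
  then have "continuous_map (topo A) (topo C) (compose (carrier A) g f)"
    by (rule continuous_map_eq) (auto simp: assms(2) compose_def)
  then show ?thesis
    using homs_compose[OF assms(1)] f g by (auto simp: choms_def)
qed

text \<open>The preimage of any set is a union of fibres, so open fibres suffice. Continuity into a
  member of \<open>\<C>\<close> thus becomes a statement about fibres, which are easy to compute for
  lifts and tuples.\<close>

lemma continuous_map_discrete_iff:
  "continuous_map X (discrete_topology U) h \<longleftrightarrow>
    h \<in> topspace X \<rightarrow> U \<and> (\<forall>u\<in>U. openin X {x \<in> topspace X. h x = u})"
proof safe
  assume c: "continuous_map X (discrete_topology U) h"
  show "h x \<in> U" if "x \<in> topspace X" for x
    using continuous_map_funspace[OF c] that by auto
  show "openin X {x \<in> topspace X. h x = u}" if "u \<in> U" for u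
    using openin_continuous_map_preimage[OF c, of "{u}"] that by simp
next
  assume h: "h \<in> topspace X \<rightarrow> U" and o: "\<forall>u\<in>U. openin X {x \<in> topspace X. h x = u}"
  have "openin X {x \<in> topspace X. h x \<in> V}" if V: "V \<subseteq> U" for V
  proof -
    have "{x \<in> topspace X. h x \<in> V} = (\<Union>u\<in>V. {x \<in> topspace X. h x = u})" by auto
    then show ?thesis using o V by (auto intro!: openin_Union)
  qed
  then show "continuous_map X (discrete_topology U) h"
    using h by (auto simp: continuous_map_def)
qed

lemma choms_discrete_iff:
  assumes "topspace (topo A) = carrier A"
  shows "h \<in> choms \<Sigma> A (discrete_alg C) \<longleftrightarrow>
    h \<in> homs \<Sigma> A C \<and> (\<forall>u\<in>carrier C. openin (topo A) {a \<in> carrier A. h a = u})"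
  using assms by (auto simp: choms_def continuous_map_discrete_iff homs_def)

lemma homs_discrete_choms: "j \<in> homs \<Sigma> D C \<Longrightarrow> j \<in> choms \<Sigma> (discrete_alg D) (discrete_alg C)"
  by (auto simp: choms_def homs_def)

lemma choms_factor:
  assumes A: "is_algebra \<Sigma> A" "topspace (topo A) = carrier A" and D: "is_algebra \<Sigma> D"
    and h: "h \<in> choms \<Sigma> A (discrete_alg C)" and j: "j \<in> homs \<Sigma> D C"
    and inj: "inj_on j (carrier D)" and im: "h ` carrier A \<subseteq> j ` carrier D"
  obtains g where "g \<in> choms \<Sigma> A (discrete_alg D)" "compose (carrier A) j g = h"
proof
  let ?g = "compose (carrier A) (inv_into (carrier D) j) h"
  have hh: "h \<in> homs \<Sigma> A C" using h by (simp add: choms_def)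
  have j1: "j (?g a) = h a" if "a \<in> carrier A" for a
    using im that by (auto simp: compose_def f_inv_into_f)
  have j2: "?g a \<in> carrier D" if "a \<in> carrier A" for a
    using im that by (auto simp: compose_def inv_into_into)
  \<comment> \<open>Injectivity of \<open>j\<close> identifies each fibre of the lift with a fibre
    of \<open>h\<close>, which carries openness over.\<close>
  have "?g a = u \<longleftrightarrow> h a = j u" if "a \<in> carrier A" "u \<in> carrier D" for a u
    using inj_on_eq_iff[OF inj j2[OF that(1)] that(2)] j1[OF that(1)] by simp
  then have "{a \<in> carrier A. ?g a = u} = {a \<in> carrier A. h a = j u}" if "u \<in> carrier D" for u
    using that by blast
  moreover have "j u \<in> carrier C" if "u \<in> carrier D" for u using homsD(1)[OF j] that by auto
  ultimately show "?g \<in> choms \<Sigma> A (discrete_alg D)"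
    using h homs_factor[OF A(1) D hh j inj im] by (simp add: choms_discrete_iff[OF A(2)])
  show "compose (carrier A) j ?g = h"
    using j1 homsD(1)[OF hh] by (intro extensionalityI[of _ "carrier A"])
      (auto simp: compose_def PiE_def)
qed

text \<open>A fibre of the tuple is an intersection of one fibre per component, hence open because
  \<open>I\<close> is finite. The product carries the discrete topology here.\<close>

lemma choms_prod_tuple:
  assumes A: "is_algebra \<Sigma> A" "topspace (topo A) = carrier A" and I: "finite I"
    and h: "\<And>i. i \<in> I \<Longrightarrow> h i \<in> choms \<Sigma> A (discrete_alg (F i))"
  shows "(\<lambda>a\<in>carrier A. \<lambda>i\<in>I. h i a) \<in> choms \<Sigma> A (discrete_alg (prod_alg \<Sigma> I F))"
proof -
  let ?H = "\<lambda>a\<in>carrier A. \<lambda>i\<in>I. h i a"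
  have "openin (topo A) {a \<in> carrier A. ?H a = u}" if u: "u \<in> carrier (prod_alg \<Sigma> I F)" for u
  proof -
    \<comment> \<open>The factor \<open>carrier A\<close> keeps the identity true for empty
      \<open>I\<close>, where the intersection over \<open>I\<close> is \<open>UNIV\<close>.\<close>
    have "{a \<in> carrier A. ?H a = u} = carrier A \<inter> (\<Inter>i\<in>I. {a \<in> carrier A. h i a = u i})"
      using u by (auto simp: prod_alg_def fun_eq_iff PiE_iff extensional_def)
    moreover have "openin (topo A) {a \<in> carrier A. h i a = u i}" if "i \<in> I" for i
      using h[OF that] u that by (auto simp: choms_discrete_iff[OF A(2)] prod_alg_def)
    moreover have "openin (topo A) (carrier A)" using A(2) openin_topspace by metis
    ultimately show ?thesis
      using I by (cases "I = {}") (auto intro!: openin_Int openin_INT)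
  qed
  then show ?thesis
    using homs_prod_tuple[OF A(1), of I h F] h by (simp add: choms_discrete_iff[OF A(2)])
qed

text \<open>Two continuous homomorphisms into a discrete algebra agree on a closed subuniverse, so
  they coincide once they agree on a finite set that generates a dense subalgebra. That set has only
  finitely many maps into \<open>carrier C\<close>.\<close>

lemma finite_choms:
  fixes A :: "('a, 'f) top_alg"
  assumes A: "topological_algebra \<Sigma> A" "topologically_fg \<Sigma> A" and C: "finite (carrier C)"
  shows "finite (choms \<Sigma> A (discrete_alg C))"
proof -
  have alg: "is_algebra \<Sigma> A" and top: "topspace (topo A) = carrier A"
    using A(1) by (auto simp: topological_algebra_def)
  obtain S where S: "finite S" "S \<subseteq> carrier A"
    and dense: "topo A closure_of (subuniverse \<Sigma> A hull S) = carrier A"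
    using A(2) by (auto simp: topologically_fg_def)
  have "f = g" if f: "f \<in> choms \<Sigma> A (discrete_alg C)" and g: "g \<in> choms \<Sigma> A (discrete_alg C)"
    and eq: "restrict f S = restrict g S" for f g
  proof -
    have fg: "f \<in> homs \<Sigma> A C" "g \<in> homs \<Sigma> A C"
      "continuous_map (topo A) (discrete_topology (carrier C)) f"
      "continuous_map (topo A) (discrete_topology (carrier C)) g"
      using f g by (simp_all add: choms_def)
    let ?Q = "{a \<in> carrier A. f a = g a}"
    have "closedin (topo A) ?Q"
      using closedin_continuous_maps_eq[OF _ fg(3,4)] top by (simp add: Hausdorff_space_discrete_topology)
    moreover have "f a = g a" if "a \<in> S" for a using fun_cong[OF eq, of a] that by simp
    then have "S \<subseteq> ?Q" using S(2) by auto
    then have "subuniverse \<Sigma> A hull S \<subseteq> ?Q"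
      by (intro hull_minimal subuniverse_equalizer[OF alg fg(1,2)])
    ultimately have "carrier A \<subseteq> ?Q" using dense closure_of_minimal[of _ ?Q "topo A"] by metis
    then show "f = g"
      using homsD(1)[OF fg(1)] homsD(1)[OF fg(2)] by (intro PiE_ext) auto
  qed
  then have "inj_on (\<lambda>f. restrict f S) (choms \<Sigma> A (discrete_alg C))" by (auto simp: inj_on_def)
  moreover have "(\<lambda>f. restrict f S) ` choms \<Sigma> A (discrete_alg C) \<subseteq> S \<rightarrow>\<^sub>E carrier C"
    using S by (auto simp: choms_def homs_def)
  ultimately show ?thesis
    using finite_PiE[OF S(1), of "\<lambda>_. carrier C"] C by (metis finite_imageD finite_subset)
qed


section \<open>Finite quotients\<close>

definition surj_choms ::
    "'f signature \<Rightarrow> ('a, 'f) top_alg \<Rightarrow> ('b, 'f) alg \<Rightarrow> ('a \<Rightarrow> 'b) set" where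
  "surj_choms \<Sigma> A C = {h \<in> choms \<Sigma> A (discrete_alg C). h ` carrier A = carrier C}"

text \<open>The isomorphism from \<open>D\<close> onto the subalgebra is composed with the inclusion
  into \<open>C\<close>. Later arguments meet subalgebras only in this form, as images of embeddings
  of members of \<open>\<C>\<close>.\<close>

lemma subuniverse_iso_member:
  assumes "closed_subalgebras \<Sigma> \<C>" "C \<in> \<C>" "subuniverse \<Sigma> C S"
  obtains D j where "D \<in> \<C>" "j \<in> homs \<Sigma> D C" "inj_on j (carrier D)" "j ` carrier D = S"
proof -
  obtain D j where "D \<in> \<C>" and j: "j \<in> homs \<Sigma> D (C\<lparr>carrier := S\<rparr>)"
    and b: "bij_betw j (carrier D) (carrier (C\<lparr>carrier := S\<rparr>))"
    using assms unfolding closed_subalgebras_def iso_alg_def by meson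
  moreover have "S \<subseteq> carrier C" using assms(3) by (simp add: subuniverse_def)
  ultimately show thesis
    using homs_carrier_update[OF j] by (intro that[of D j]) (auto simp: bij_betw_def)
qed

lemma compose_image: "compose S g f ` S = g ` f ` S"
  by (auto simp: compose_def)

text \<open>A map whose image is that of the embedding \<open>j\<close> lifts uniquely along
  \<open>j\<close>, and the lift is onto. This converts the count of maps with a prescribed image
  into a count of surjections onto a member of \<open>\<C>\<close>.\<close>

lemma bij_betw_surj_choms:
  assumes A: "is_algebra \<Sigma> A" "topspace (topo A) = carrier A" and D: "is_algebra \<Sigma> D"
    and j: "j \<in> homs \<Sigma> D C" "inj_on j (carrier D)"
  shows "bij_betw (compose (carrier A) j) (surj_choms \<Sigma> A D)
    {h \<in> choms \<Sigma> A (discrete_alg C). h ` carrier A = j ` carrier D}"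
  unfolding bij_betw_def
proof
  show "inj_on (compose (carrier A) j) (surj_choms \<Sigma> A D)"
  proof (rule inj_onI)
    fix f g assume f: "f \<in> surj_choms \<Sigma> A D" and g: "g \<in> surj_choms \<Sigma> A D"
      and eq: "compose (carrier A) j f = compose (carrier A) j g"
    have fg: "f \<in> carrier A \<rightarrow>\<^sub>E carrier D" "g \<in> carrier A \<rightarrow>\<^sub>E carrier D"
      using f g by (auto simp: surj_choms_def choms_def homs_def)
    have "f a = g a" if "a \<in> carrier A" for a
      using fun_cong[OF eq, of a] that fg by (auto simp: compose_def dest!: inj_onD[OF j(2)])
    then show "f = g" using fg by (intro PiE_ext) auto
  qed
  show "compose (carrier A) j ` surj_choms \<Sigma> A D =
      {h \<in> choms \<Sigma> A (discrete_alg C). h ` carrier A = j ` carrier D}" (is "?L = ?R")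
  proof (intro equalityI subsetI)
    fix h assume "h \<in> ?L"
    then obtain g where g: "g \<in> surj_choms \<Sigma> A D" "h = compose (carrier A) j g" by auto
    then show "h \<in> ?R"
      using choms_compose[OF A _ homs_discrete_choms[OF j(1)], of g]
      by (auto simp: surj_choms_def compose_image)
  next
    fix h assume "h \<in> ?R"
    then have h: "h \<in> choms \<Sigma> A (discrete_alg C)" "h ` carrier A = j ` carrier D" by auto
    from choms_factor[OF A D h(1) j] h(2)
    obtain g where g: "g \<in> choms \<Sigma> A (discrete_alg D)" "compose (carrier A) j g = h" by auto
    have "j ` g ` carrier A = j ` carrier D"
      using g(2) h(2) by (metis compose_image)
    moreover have "g ` carrier A \<subseteq> carrier D"
      using g(1) by (auto simp: choms_def homs_def)
    ultimately have "g ` carrier A = carrier D"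
      using inj_on_image_eq_iff[OF j(2), of "g ` carrier A" "carrier D"] by simp
    then show "h \<in> ?L" using g by (auto simp: surj_choms_def)
  qed
qed

(* Every homomorphism is onto its image, so the total counts are sums of surjection counts over
   subalgebras, from which the latter are recovered by induction. *)
lemma card_surj_choms_eq:
  fixes A :: "('a, 'f) top_alg" and B :: "('b, 'f) top_alg" and \<C> :: "('c, 'f) alg set"
  assumes A: "is_algebra \<Sigma> A" "topspace (topo A) = carrier A"
    and B: "is_algebra \<Sigma> B" "topspace (topo B) = carrier B"
    and sub: "closed_subalgebras \<Sigma> \<C>"
    and alg: "\<And>C. C \<in> \<C> \<Longrightarrow> is_algebra \<Sigma> C" and fin: "\<And>C. C \<in> \<C> \<Longrightarrow> finite (carrier C)"
    and finA: "\<And>C. C \<in> \<C> \<Longrightarrow> finite (choms \<Sigma> A (discrete_alg C))"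
    and finB: "\<And>C. C \<in> \<C> \<Longrightarrow> finite (choms \<Sigma> B (discrete_alg C))"
    and eq: "\<And>C. C \<in> \<C> \<Longrightarrow>
      card (choms \<Sigma> A (discrete_alg C)) = card (choms \<Sigma> B (discrete_alg C))"
  shows "C \<in> \<C> \<Longrightarrow> card (surj_choms \<Sigma> A C) = card (surj_choms \<Sigma> B C)"
proof (induction "card (carrier C)" arbitrary: C rule: less_induct)
  case less
  note C = less.prems
  let ?U = "Collect (subuniverse \<Sigma> C)"
  have finU: "finite ?U"
    by (rule finite_subset[of _ "Pow (carrier C)"]) (auto simp: subuniverse_def fin[OF C])
  have CU: "carrier C \<in> ?U" using subuniverse_carrier[OF alg[OF C]] by simp
  \<comment> \<open>Stated for a generic \<open>X\<close>, since it is applied to both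
    \<open>A\<close> and \<open>B\<close>, whose carrier types differ.\<close>
  have total: "card (choms \<Sigma> X (discrete_alg C)) = card (surj_choms \<Sigma> X C) +
      (\<Sum>S\<in>?U - {carrier C}. card {h \<in> choms \<Sigma> X (discrete_alg C). h ` carrier X = S})"
    if X: "is_algebra \<Sigma> X" and finX: "finite (choms \<Sigma> X (discrete_alg C))"
    for X :: "('x, 'f) top_alg"
  proof -
    have "choms \<Sigma> X (discrete_alg C) =
        (\<Union>S\<in>?U. {h \<in> choms \<Sigma> X (discrete_alg C). h ` carrier X = S})"
      using subuniverse_image[OF X] by (auto simp: choms_def)
    then have "card (choms \<Sigma> X (discrete_alg C)) =
        card (\<Union>S\<in>?U. {h \<in> choms \<Sigma> X (discrete_alg C). h ` carrier X = S})" by (rule arg_cong)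
    also have "\<dots> = (\<Sum>S\<in>?U. card {h \<in> choms \<Sigma> X (discrete_alg C). h ` carrier X = S})"
      using finU finX by (intro card_UN_disjoint) auto
    also have "\<dots> = card (surj_choms \<Sigma> X C) +
      (\<Sum>S\<in>?U - {carrier C}. card {h \<in> choms \<Sigma> X (discrete_alg C). h ` carrier X = S})"
      unfolding surj_choms_def by (rule sum.remove[OF finU CU])
    finally show ?thesis .
  qed
  \<comment> \<open>A proper subuniverse \<open>S\<close> of the finite \<open>C\<close> is a copy
    of a member \<open>D\<close> with fewer elements, so the induction hypothesis matches the two
    summands.\<close>
  have "card {h \<in> choms \<Sigma> A (discrete_alg C). h ` carrier A = S} =
      card {h \<in> choms \<Sigma> B (discrete_alg C). h ` carrier B = S}"
    if S: "S \<in> ?U - {carrier C}" for S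
  proof -
    obtain D j where D: "D \<in> \<C>" and j: "j \<in> homs \<Sigma> D C" "inj_on j (carrier D)"
      and jS: "j ` carrier D = S"
      using S by (auto intro: subuniverse_iso_member[OF sub C])
    have "S \<subset> carrier C" using S by (auto simp: subuniverse_def)
    then have "card S < card (carrier C)" by (rule psubset_card_mono[OF fin[OF C]])
    then have "card (carrier D) < card (carrier C)" using card_image[OF j(2)] jS by simp
    then have "card (surj_choms \<Sigma> A D) = card (surj_choms \<Sigma> B D)" using less.hyps D by blast
    then show ?thesis
      using bij_betw_same_card[OF bij_betw_surj_choms[OF A alg[OF D] j]]
        bij_betw_same_card[OF bij_betw_surj_choms[OF B alg[OF D] j]] jS by simp
  qed
  then show ?case
    using total[OF A(1) finA[OF C]] total[OF B(1) finB[OF C]] eq[OF C] by simp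
qed

text \<open>The family \<open>F\<close> is bundled into one homomorphism to a finite product. The
  image of this map, copied as a member \<open>D\<close> of \<open>\<C>\<close>, is a single finite
  quotient of \<open>B\<close> through which every map in \<open>F\<close> factors.\<close>

lemma joint_quotient:
  fixes B :: "('b, 'f) top_alg" and \<C> :: "('c, 'f) alg set"
  assumes B: "is_algebra \<Sigma> B" "topspace (topo B) = carrier B"
    and sub: "closed_subalgebras \<Sigma> \<C>" and prod: "closed_finite_products \<Sigma> \<C>"
    and alg: "\<And>C. C \<in> \<C> \<Longrightarrow> is_algebra \<Sigma> C"
    and F: "finite F" "\<And>C h. (C, h) \<in> F \<Longrightarrow> C \<in> \<C> \<and> h \<in> choms \<Sigma> B (discrete_alg C)"
  obtains D k r where "D \<in> \<C>" "k \<in> surj_choms \<Sigma> B D"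
    "\<And>p. p \<in> F \<Longrightarrow> r p \<in> homs \<Sigma> D (fst p)"
    "\<And>p. p \<in> F \<Longrightarrow> compose (carrier B) (r p) k = snd p"
proof -
  \<comment> \<open>\<open>closed_finite_products\<close> speaks of index sets of natural numbers,
    so \<open>F\<close> is enumerated.\<close>
  obtain e n where e: "bij_betw e {..<n::nat} F"
    using ex_bij_betw_nat_finite[OF F(1)] by (auto simp: atLeast0LessThan)
  have eF: "fst (e i) \<in> \<C>" "snd (e i) \<in> choms \<Sigma> B (discrete_alg (fst (e i)))" if "i < n" for i
    using F(2)[of "fst (e i)" "snd (e i)"] bij_betwE[OF e] that by auto
  define P where "P = prod_alg \<Sigma> {..<n} (\<lambda>i. fst (e i))"
  define H where "H = (\<lambda>b\<in>carrier B. \<lambda>i\<in>{..<n}. snd (e i) b)"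
  have H: "H \<in> choms \<Sigma> B (discrete_alg P)"
    unfolding H_def P_def using eF by (intro choms_prod_tuple[OF B]) auto
  have algP: "is_algebra \<Sigma> (fst (e i))" if "i \<in> {..<n}" for i using alg eF that by simp
  obtain D0 j0 where D0: "D0 \<in> \<C>" and j0: "j0 \<in> homs \<Sigma> D0 P"
    and bj0: "bij_betw j0 (carrier D0) (carrier P)"
    using prod eF(1) unfolding closed_finite_products_def iso_alg_def P_def
    by (metis finite_lessThan lessThan_iff)
  have "H ` carrier B \<subseteq> j0 ` carrier D0"
    using H bj0 by (auto simp: choms_def homs_def bij_betw_def)
  then obtain G where G: "G \<in> choms \<Sigma> B (discrete_alg D0)" and G0: "compose (carrier B) j0 G = H"
    using choms_factor[OF B alg[OF D0] H j0] bj0 by (auto simp: bij_betw_def)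
  have "subuniverse \<Sigma> D0 (G ` carrier B)"
    using G by (intro subuniverse_image[OF B(1)]) (simp add: choms_def)
  then obtain D j where D: "D \<in> \<C>" and j: "j \<in> homs \<Sigma> D D0" "inj_on j (carrier D)"
    and jD: "j ` carrier D = G ` carrier B"
    by (rule subuniverse_iso_member[OF sub D0])
  have "G \<in> compose (carrier B) j ` surj_choms \<Sigma> B D"
    unfolding bij_betw_imp_surj_on[OF bij_betw_surj_choms[OF B alg[OF D] j]] using G jD by simp
  then obtain k where k: "k \<in> surj_choms \<Sigma> B D" and kG: "compose (carrier B) j k = G"
    by blast
  define \<pi> where "\<pi> i = (\<lambda>x\<in>carrier P. x i)" for i :: nat
  \<comment> \<open>The way from \<open>D\<close> to the codomain of \<open>p\<close>: into
    \<open>D0\<close>, over to the product, then to the coordinate that \<open>e\<close> assigns to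
    \<open>p\<close>.\<close>
  define r where "r p = compose (carrier D) (\<pi> (inv_into {..<n} e p)) (compose (carrier D) j0 j)"
    for p
  show thesis
  proof (rule that[OF D k])
    fix p assume p: "p \<in> F"
    define i where "i = inv_into {..<n} e p"
    have i: "i \<in> {..<n}" "e i = p"
      using p e by (auto simp: i_def bij_betw_def inv_into_into f_inv_into_f)
    have "\<pi> i \<in> homs \<Sigma> P (fst p)"
      using homs_prod_projection[of i "{..<n}" \<Sigma> "\<lambda>i. fst (e i)"] i algP
      by (simp add: \<pi>_def P_def)
    then show "r p \<in> homs \<Sigma> D (fst p)"
      unfolding r_def i_def[symmetric]
      by (intro homs_compose[OF alg[OF D] homs_compose[OF alg[OF D] j(1) j0]])
    have kD: "k b \<in> carrier D" if "b \<in> carrier B" for b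
      using k that by (auto simp: surj_choms_def)
    have "r p (k b) = snd p b" if b: "b \<in> carrier B" for b
    proof -
      have "j0 (j (k b)) = H b"
        using fun_cong[OF G0, of b] fun_cong[OF kG, of b] b by (simp add: compose_def)
      moreover have "H b \<in> carrier P" using H b by (auto simp: choms_def homs_def)
      ultimately show ?thesis
        using kD[OF b] i b by (simp add: r_def i_def[symmetric] compose_def \<pi>_def H_def)
    qed
    moreover have "snd p \<in> extensional (carrier B)"
      using eF(2)[of i] i by (auto simp: choms_def homs_def PiE_def)
    ultimately show "compose (carrier B) (r p) k = snd p"
      by (intro extensionalityI[of _ "carrier B"]) (auto simp: compose_def)
  qed
qed


section \<open>Compactness\<close>

lemma compact_family:
  assumes X: "compact_space X" and closed: "\<And>i. i \<in> I \<Longrightarrow> closedin X (K i)"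
    and fip: "\<And>F. \<lbrakk>finite F; F \<subseteq> I\<rbrakk> \<Longrightarrow> \<exists>x\<in>topspace X. \<forall>i\<in>F. x \<in> K i"
  shows "\<exists>x\<in>topspace X. \<forall>i\<in>I. x \<in> K i"
proof -
  \<comment> \<open>With \<open>topspace X\<close> among the sets, the common point lies in the
    space even if \<open>I\<close> is empty.\<close>
  let ?U = "insert (topspace X) (K ` I)"
  have "\<Inter>\<F> \<noteq> {}" if "finite \<F>" "\<F> \<subseteq> ?U" for \<F>
  proof -
    have "\<F> - {topspace X} \<subseteq> K ` I" using that by auto
    with that(1) have "\<exists>F\<subseteq>I. finite F \<and> \<F> - {topspace X} = K ` F"
      by (intro finite_subset_image) auto
    then obtain F where F: "F \<subseteq> I" "finite F" "\<F> - {topspace X} = K ` F" by blast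
    obtain x where x: "x \<in> topspace X" "\<forall>i\<in>F. x \<in> K i" using fip[OF F(2,1)] by blast
    have "x \<in> S" if "S \<in> \<F>" for S
    proof (cases "S = topspace X")
      case False
      with that F(3) have "S \<in> K ` F" by blast
      with x(2) show ?thesis by blast
    qed (use x in simp)
    then show ?thesis by blast
  qed
  then have "\<Inter>?U \<noteq> {}"
    using X[unfolded compact_space_fip, rule_format, of ?U] closed by auto
  then show ?thesis by auto
qed

text \<open>\<open>Q\<close> sees only finitely many discrete coordinates, so the basic open set
  that freezes these coordinates at those of \<open>x\<close> stays inside the condition. The
  complement is a set of the same kind; hence the local claim is made for every \<open>Q\<close> and
  applied to the negation.\<close>

lemma closedin_product_discrete:
  assumes F: "finite F" "F \<subseteq> I"
  shows "closedin (product_topology (\<lambda>i. discrete_topology (U i)) I) {x \<in> Pi\<^sub>E I U. Q (restrict x F)}"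
proof -
  let ?T = "product_topology (\<lambda>i. discrete_topology (U i)) I"
  have o: "openin ?T {x \<in> Pi\<^sub>E I U. Q (restrict x F)}" for Q
  proof (subst openin_subopen, intro ballI)
    fix x assume x: "x \<in> {x \<in> Pi\<^sub>E I U. Q (restrict x F)}"
    let ?V = "\<lambda>i. if i \<in> F then {x i} else U i"
    have "openin ?T (Pi\<^sub>E I ?V)"
    proof (rule product_topology_basis)
      show "finite {i. ?V i \<noteq> topspace (discrete_topology (U i))}"
        by (rule finite_subset[OF _ F(1)]) auto
    qed (use x F in auto)
    moreover have "x \<in> Pi\<^sub>E I ?V" using x by auto
    moreover have "y \<in> Pi\<^sub>E I U \<and> Q (restrict y F)" if y: "y \<in> Pi\<^sub>E I ?V" for y
    proof -
      have "y i = x i" if "i \<in> F" for i using PiE_mem[OF y, of i] that F by auto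
      then have "restrict y F = restrict x F" by (intro restrict_ext)
      moreover have "?V i \<subseteq> U i" if "i \<in> I" for i using x that by auto
      then have "Pi\<^sub>E I ?V \<subseteq> Pi\<^sub>E I U" by (rule PiE_mono)
      ultimately show ?thesis using x y by auto
    qed
    ultimately show "\<exists>T. openin ?T T \<and> x \<in> T \<and> T \<subseteq> {x \<in> Pi\<^sub>E I U. Q (restrict x F)}"
      by (intro exI[of _ "Pi\<^sub>E I ?V"]) auto
  qed
  have "topspace ?T - {x \<in> Pi\<^sub>E I U. Q (restrict x F)} = {x \<in> Pi\<^sub>E I U. \<not> Q (restrict x F)}" by auto
  with o[of "\<lambda>x. \<not> Q x"] show ?thesis by (auto simp: closedin_def)
qed

text \<open>For finite \<open>F\<close>, \<open>joint_quotient\<close> yields \<open>k\<close> from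
  \<open>B\<close> onto some \<open>D\<close> together with factor maps \<open>r p\<close>. Any
  \<open>k'\<close> from \<open>A\<close> onto \<open>D\<close>, followed by the same
  \<open>r p\<close>, has the same joint image. Compactness of the product of the finite sets of
  homomorphisms merges these choices into one \<open>\<Phi>\<close>. The indices are pairs because a
  function alone does not determine its codomain \<open>C\<close>.\<close>

lemma compatible_family:
  fixes A :: "('a, 'f) top_alg" and B :: "('b, 'f) top_alg" and \<C> :: "('c, 'f) alg set"
  assumes A: "is_algebra \<Sigma> A" "topspace (topo A) = carrier A"
    and B: "is_algebra \<Sigma> B" "topspace (topo B) = carrier B"
    and sub: "closed_subalgebras \<Sigma> \<C>" and prod: "closed_finite_products \<Sigma> \<C>"
    and alg: "\<And>C. C \<in> \<C> \<Longrightarrow> is_algebra \<Sigma> C"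
    and fin: "\<And>C. C \<in> \<C> \<Longrightarrow> finite (choms \<Sigma> A (discrete_alg C))"
    and surj: "\<And>D. D \<in> \<C> \<Longrightarrow> surj_choms \<Sigma> B D \<noteq> {} \<Longrightarrow> surj_choms \<Sigma> A D \<noteq> {}"
  defines "I \<equiv> {(C, h). C \<in> \<C> \<and> h \<in> choms \<Sigma> B (discrete_alg C)}"
  obtains \<Phi> where "\<forall>p\<in>I. \<Phi> p \<in> choms \<Sigma> A (discrete_alg (fst p))"
    "\<forall>F. finite F \<longrightarrow> F \<subseteq> I \<longrightarrow>
      (\<lambda>a. \<lambda>p\<in>F. \<Phi> p a) ` carrier A = (\<lambda>b. \<lambda>p\<in>F. snd p b) ` carrier B"
proof -
  define U where "U p = choms \<Sigma> A (discrete_alg (fst p))"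
    for p :: "('c, 'f) alg \<times> ('b \<Rightarrow> 'c)"
  define J where "J = {F. finite F \<and> F \<subseteq> I}"
  define Q where "Q F \<Phi> \<longleftrightarrow>
      (\<lambda>a. \<lambda>p\<in>F. \<Phi> p a) ` carrier A = (\<lambda>b. \<lambda>p\<in>F. snd p b) ` carrier B"
    for F and \<Phi> :: "('c, 'f) alg \<times> ('b \<Rightarrow> 'c) \<Rightarrow> 'a \<Rightarrow> 'c"
  let ?T = "product_topology (\<lambda>p. discrete_topology (U p)) I"
  \<comment> \<open>Only the coordinates in \<open>F\<close> matter, which brings the condition into
    the form required by \<open>closedin_product_discrete\<close>.\<close>
  have Q_restrict: "Q F (restrict \<Phi> F) \<longleftrightarrow> Q F \<Phi>" for F \<Phi>
    unfolding Q_def by (auto cong: restrict_cong)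
  \<comment> \<open>Coordinates can be forgotten, so finitely many conditions follow from the single
    one for the union of their index sets.\<close>
  have Q_mono: "Q F \<Phi>" if "Q G \<Phi>" "F \<subseteq> G" for F G \<Phi>
  proof -
    have "(\<lambda>a. \<lambda>p\<in>F. \<Phi> p a) ` carrier A = (\<lambda>x. restrict x F) ` (\<lambda>a. \<lambda>p\<in>G. \<Phi> p a) ` carrier A"
      using that(2) by (simp add: image_image Int_absorb1)
    also have "\<dots> = (\<lambda>b. \<lambda>p\<in>F. snd p b) ` carrier B"
      using that unfolding Q_def by (simp add: image_image Int_absorb1)
    finally show ?thesis unfolding Q_def .
  qed
  have fgU: "finite (U p)" if "p \<in> I" for p using that fin by (auto simp: I_def U_def)
  have ne: "\<exists>\<Phi>\<in>Pi\<^sub>E I U. Q F \<Phi>" if F: "F \<in> J" for F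
  proof -
    have quot: "\<exists>D\<in>\<C>. \<exists>k'\<in>surj_choms \<Sigma> A D. \<exists>k\<in>surj_choms \<Sigma> B D. \<exists>r. \<forall>p\<in>F.
        r p \<in> homs \<Sigma> D (fst p) \<and> compose (carrier B) (r p) k = snd p"
      if F: "F \<in> J" for F
    proof -
      obtain D k r where D: "D \<in> \<C>" "k \<in> surj_choms \<Sigma> B D"
        "\<And>p. p \<in> F \<Longrightarrow> r p \<in> homs \<Sigma> D (fst p)"
        "\<And>p. p \<in> F \<Longrightarrow> compose (carrier B) (r p) k = snd p"
        by (rule joint_quotient[OF B sub prod alg, of F]) (use F in \<open>auto simp: J_def I_def\<close>)
      with surj[OF D(1)] show ?thesis by blast
    qed
    obtain D k' k r where D: "D \<in> \<C>" and k': "k' \<in> surj_choms \<Sigma> A D"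
      and k: "k \<in> surj_choms \<Sigma> B D"
      and r: "\<And>p. p \<in> F \<Longrightarrow> r p \<in> homs \<Sigma> D (fst p)"
        "\<And>p. p \<in> F \<Longrightarrow> compose (carrier B) (r p) k = snd p"
      using quot[OF F] by metis
    have comp: "compose (carrier A) (r p) k' \<in> U p" if "p \<in> F" for p
      unfolding U_def using k' r(1)[OF that]
      by (intro choms_compose[OF A _ homs_discrete_choms]) (auto simp: surj_choms_def)
    \<comment> \<open>A point of the full product needs a default value at each coordinate outside
      \<open>F\<close>; the singleton case of \<open>quot\<close> provides one.\<close>
    have "U p \<noteq> {}" if p: "p \<in> I" for p
    proof -
      have "{p} \<in> J" using p by (simp add: J_def)
      from quot[OF this] obtain D' :: "('c, 'f) alg" and l t
        where l: "l \<in> surj_choms \<Sigma> A D'" "t \<in> homs \<Sigma> D' (fst p)"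
        by blast
      then have "compose (carrier A) t l \<in> U p"
        unfolding U_def
        by (intro choms_compose[OF A _ homs_discrete_choms]) (auto simp: surj_choms_def)
      then show ?thesis by auto
    qed
    then have "Pi\<^sub>E I U \<noteq> {}" by (simp add: PiE_eq_empty_iff)
    then obtain \<Psi> where \<Psi>: "\<Psi> \<in> Pi\<^sub>E I U" by blast
    define \<Phi> where "\<Phi> = (\<lambda>p\<in>I. if p \<in> F then compose (carrier A) (r p) k' else \<Psi> p)"
    have FI: "F \<subseteq> I" using F by (simp add: J_def)
    have "\<Phi> \<in> Pi\<^sub>E I U" using comp \<Psi> by (auto simp: \<Phi>_def)
    moreover have "Q F \<Phi>"
    proof -
      have "(\<lambda>a. \<lambda>p\<in>F. \<Phi> p a) ` carrier A = (\<lambda>d. \<lambda>p\<in>F. r p d) ` k' ` carrier A"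
        unfolding image_image using FI
        by (intro image_cong refl restrict_ext) (auto simp: \<Phi>_def compose_def)
      also have "k' ` carrier A = k ` carrier B" using k k' by (simp add: surj_choms_def)
      also have "(\<lambda>d. \<lambda>p\<in>F. r p d) ` k ` carrier B = (\<lambda>b. \<lambda>p\<in>F. snd p b) ` carrier B"
        unfolding image_image
      proof (intro image_cong refl restrict_ext)
        fix b p assume "b \<in> carrier B" "p \<in> F"
        then show "r p (k b) = snd p b" using fun_cong[OF r(2), of p b] by (simp add: compose_def)
      qed
      finally show ?thesis unfolding Q_def .
    qed
    ultimately show ?thesis by blast
  qed
  have "\<exists>\<Phi>\<in>topspace ?T. \<forall>F\<in>J. \<Phi> \<in> {\<Phi> \<in> Pi\<^sub>E I U. Q F (restrict \<Phi> F)}"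
  proof (rule compact_family)
    show "compact_space ?T"
      using fgU by (simp add: compact_space_product_topology compact_space_discrete_topology)
    show "closedin ?T {\<Phi> \<in> Pi\<^sub>E I U. Q F (restrict \<Phi> F)}" if "F \<in> J" for F
      using that by (intro closedin_product_discrete) (auto simp: J_def)
    fix G assume G: "finite G" "G \<subseteq> J"
    then have "\<Union>G \<in> J" by (auto simp: J_def)
    then obtain \<Phi> where "\<Phi> \<in> Pi\<^sub>E I U" "Q (\<Union>G) \<Phi>" using ne by blast
    then show "\<exists>\<Phi>\<in>topspace ?T. \<forall>F\<in>G. \<Phi> \<in> {\<Phi> \<in> Pi\<^sub>E I U. Q F (restrict \<Phi> F)}"
      using Q_mono[of "\<Union>G" \<Phi>] by (intro bexI[of _ \<Phi>]) (simp_all add: Q_restrict Union_upper)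
  qed
  then obtain \<Phi> where \<Phi>: "\<Phi> \<in> Pi\<^sub>E I U" "\<And>F. F \<in> J \<Longrightarrow> Q F \<Phi>" by (auto simp: Q_restrict)
  show thesis
  proof (rule that)
    show "\<forall>p\<in>I. \<Phi> p \<in> choms \<Sigma> A (discrete_alg (fst p))"
      using PiE_mem[OF \<Phi>(1)] unfolding U_def by blast
    show "\<forall>F. finite F \<longrightarrow> F \<subseteq> I \<longrightarrow>
        (\<lambda>a. \<lambda>p\<in>F. \<Phi> p a) ` carrier A = (\<lambda>b. \<lambda>p\<in>F. snd p b) ` carrier B"
      using \<Phi>(2) by (simp add: J_def Q_def)
  qed
qed

section \<open>The isomorphism as a closed relation\<close>

lemma iso_from_compatible_family:
  fixes A :: "('a, 'f) top_alg" and B :: "('b, 'f) top_alg" and \<C> :: "('c, 'f) alg set"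
  assumes A: "topological_algebra \<Sigma> A" "compact_space (topo A)"
    and B: "topological_algebra \<Sigma> B" "compact_space (topo B)"
    and sepA: "\<And>a a'. \<lbrakk>a \<in> carrier A; a' \<in> carrier A;
        \<And>C h. \<lbrakk>C \<in> \<C>; h \<in> choms \<Sigma> A (discrete_alg C)\<rbrakk> \<Longrightarrow> h a = h a'\<rbrakk> \<Longrightarrow> a = a'"
    and sepB: "\<And>b b'. \<lbrakk>b \<in> carrier B; b' \<in> carrier B;
        \<And>C h. \<lbrakk>C \<in> \<C>; h \<in> choms \<Sigma> B (discrete_alg C)\<rbrakk> \<Longrightarrow> h b = h b'\<rbrakk> \<Longrightarrow> b = b'"
    and I: "I = {(C, h). C \<in> \<C> \<and> h \<in> choms \<Sigma> B (discrete_alg C)}"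
    and \<Phi>: "\<And>p. p \<in> I \<Longrightarrow> \<Phi> p \<in> choms \<Sigma> A (discrete_alg (fst p))"
    and compat: "\<And>F. \<lbrakk>finite F; F \<subseteq> I\<rbrakk> \<Longrightarrow>
      (\<lambda>a. \<lambda>p\<in>F. \<Phi> p a) ` carrier A = (\<lambda>b. \<lambda>p\<in>F. snd p b) ` carrier B"
    and onto: "\<And>C g. \<lbrakk>C \<in> \<C>; g \<in> choms \<Sigma> A (discrete_alg C)\<rbrakk> \<Longrightarrow>
      \<exists>h\<in>choms \<Sigma> B (discrete_alg C). \<Phi> (C, h) = g"
  shows "iso_top_alg \<Sigma> A B"
proof -
  have algA: "is_algebra \<Sigma> A" and algB: "is_algebra \<Sigma> B"
    and tA: "topspace (topo A) = carrier A" and tB: "topspace (topo B) = carrier B"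
    using A B by (auto simp: topological_algebra_def)
  define R where "R = {(a, b). a \<in> carrier A \<and> b \<in> carrier B \<and> (\<forall>p\<in>I. \<Phi> p a = snd p b)}"
  have cA: "continuous_map (topo A) (discrete_topology (carrier (fst p))) (\<Phi> p)"
    and hA: "\<Phi> p \<in> homs \<Sigma> A (fst p)" if "p \<in> I" for p
    using \<Phi>[OF that] by (simp_all add: choms_def)
  have cB: "continuous_map (topo B) (discrete_topology (carrier (fst p))) (snd p)"
    and hB: "snd p \<in> homs \<Sigma> B (fst p)" if "p \<in> I" for p
    using that by (auto simp: I choms_def)
  \<comment> \<open>Each \<open>p\<close> contributes an equalizer of two maps into a discrete,
    hence Hausdorff, space. Adding the whole space covers the case of empty
    \<open>I\<close>.\<close>
  have closedR: "closedin (prod_topology (topo A) (topo B)) R"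
  proof -
    let ?T = "prod_topology (topo A) (topo B)"
    let ?K = "\<lambda>p. {x \<in> topspace ?T. (\<Phi> p \<circ> fst) x = (snd p \<circ> snd) x}"
    have "closedin ?T (?K p)" if "p \<in> I" for p
      using cA[OF that] cB[OF that]
      by (intro closedin_continuous_maps_eq[where Y = "discrete_topology (carrier (fst p))"]
          continuous_map_compose[OF continuous_map_fst] continuous_map_compose[OF continuous_map_snd])
        (auto simp: Hausdorff_space_discrete_topology)
    then have "closedin ?T (\<Inter>(insert (topspace ?T) (?K ` I)))"
      by (intro closedin_Inter) (auto simp del: topspace_prod_topology)
    moreover have "\<Inter>(insert (topspace ?T) (?K ` I)) = R" by (auto simp: R_def tA tB)
    ultimately show ?thesis by simp
  qed
  \<comment> \<open>A partner of \<open>a\<close> has to solve the equations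
    \<open>snd p b = \<Phi> p a\<close> for all \<open>p\<close>. Each has a closed solution set in
    \<open>B\<close>, and equality of joint images solves finitely many at once.\<close>
  have exB: "\<exists>b. (a, b) \<in> R" if a: "a \<in> carrier A" for a
  proof -
    have "\<exists>b\<in>topspace (topo B). \<forall>p\<in>I. b \<in> {b \<in> topspace (topo B). snd p b \<in> {\<Phi> p a}}"
    proof (rule compact_family[OF B(2)])
      show "closedin (topo B) {b \<in> topspace (topo B). snd p b \<in> {\<Phi> p a}}" if "p \<in> I" for p
        using homsD(1)[OF hA[OF that]] a
        by (intro closedin_continuous_map_preimage[OF cB[OF that]]) auto
      fix F assume F: "finite F" "F \<subseteq> I"
      have "(\<lambda>p\<in>F. \<Phi> p a) \<in> (\<lambda>b. \<lambda>p\<in>F. snd p b) ` carrier B"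
        using compat[OF F] a by blast
      then obtain b where b: "b \<in> carrier B" "(\<lambda>p\<in>F. \<Phi> p a) = (\<lambda>p\<in>F. snd p b)" by auto
      have "snd p b = \<Phi> p a" if "p \<in> F" for p using fun_cong[OF b(2), of p] that by simp
      then show "\<exists>b\<in>topspace (topo B). \<forall>p\<in>F. b \<in> {b \<in> topspace (topo B). snd p b \<in> {\<Phi> p a}}"
        using b(1) tB by auto
    qed
    then obtain b where "b \<in> carrier B" "\<forall>p\<in>I. snd p b = \<Phi> p a" using tB by auto
    then have "(a, b) \<in> R" using a by (simp add: R_def)
    then show ?thesis by blast
  qed
  have exA: "\<exists>a. (a, b) \<in> R" if b: "b \<in> carrier B" for b
  proof -
    have "\<exists>a\<in>topspace (topo A). \<forall>p\<in>I. a \<in> {a \<in> topspace (topo A). \<Phi> p a \<in> {snd p b}}"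
    proof (rule compact_family[OF A(2)])
      show "closedin (topo A) {a \<in> topspace (topo A). \<Phi> p a \<in> {snd p b}}" if "p \<in> I" for p
        using homsD(1)[OF hB[OF that]] b
        by (intro closedin_continuous_map_preimage[OF cA[OF that]]) auto
      fix F assume F: "finite F" "F \<subseteq> I"
      have "(\<lambda>p\<in>F. snd p b) \<in> (\<lambda>a. \<lambda>p\<in>F. \<Phi> p a) ` carrier A"
        using compat[OF F] b by blast
      then obtain a where a: "a \<in> carrier A" "(\<lambda>p\<in>F. snd p b) = (\<lambda>p\<in>F. \<Phi> p a)" by auto
      have "snd p b = \<Phi> p a" if "p \<in> F" for p using fun_cong[OF a(2), of p] that by simp
      then show "\<exists>a\<in>topspace (topo A). \<forall>p\<in>F. a \<in> {a \<in> topspace (topo A). \<Phi> p a \<in> {snd p b}}"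
        using a(1) tA by auto
    qed
    then show ?thesis using b tA by (auto simp: R_def)
  qed
  have uniqB: "b = b'" if "(a, b) \<in> R" "(a, b') \<in> R" for a b b'
  proof (rule sepB)
    fix C h assume "C \<in> \<C>" "h \<in> choms \<Sigma> B (discrete_alg C)"
    then have "(C, h) \<in> I" by (simp add: I)
    then show "h b = h b'" using that by (force simp: R_def)
  qed (use that in \<open>auto simp: R_def\<close>)
  \<comment> \<open>Points of \<open>A\<close> are separated by all maps into \<open>\<C>\<close>,
    whereas \<open>R\<close> controls only those of the form \<open>\<Phi> p\<close>. The hypothesis
    \<open>onto\<close> closes this gap.\<close>
  have uniqA: "a = a'" if "(a, b) \<in> R" "(a', b) \<in> R" for a a' b
  proof (rule sepA)
    fix C g assume C: "C \<in> \<C>" and g: "g \<in> choms \<Sigma> A (discrete_alg C)"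
    obtain h where "h \<in> choms \<Sigma> B (discrete_alg C)" "\<Phi> (C, h) = g" using onto[OF C g] by auto
    moreover from this have "(C, h) \<in> I" using C by (simp add: I)
    ultimately show "g a = g a'" using that by (force simp: R_def)
  qed (use that in \<open>auto simp: R_def\<close>)
  obtain \<phi>0 where \<phi>0: "\<And>a. a \<in> carrier A \<Longrightarrow> (a, \<phi>0 a) \<in> R" using exB by metis
  define \<phi> where "\<phi> = restrict \<phi>0 (carrier A)"
  have \<phi>: "(a, \<phi> a) \<in> R" if "a \<in> carrier A" for a using \<phi>0[OF that] that by (simp add: \<phi>_def)
  have \<phi>B: "\<phi> a \<in> carrier B" if "a \<in> carrier A" for a using \<phi>[OF that] by (simp add: R_def)
  have \<phi>p: "snd p (\<phi> a) = \<Phi> p a" if "a \<in> carrier A" "p \<in> I" for a p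
    using \<phi>[OF that(1)] that(2) by (simp add: R_def)
  have RA: "a \<in> carrier A" if "(a, b) \<in> R" for a b using that by (simp add: R_def)
  have graph: "(a, b) \<in> R \<longleftrightarrow> a \<in> carrier A \<and> \<phi> a = b" for a b
    using \<phi> uniqB RA by metis
  have hom: "\<phi> \<in> homs \<Sigma> A B"
  proof -
    have "\<phi> (opn A s x) = opn B s (\<lambda>i\<in>{..<arity \<Sigma> s}. \<phi> (x i))"
      if s: "s \<in> syms \<Sigma>" and x: "x \<in> {..<arity \<Sigma> s} \<rightarrow>\<^sub>E carrier A" for s x
    proof -
      let ?y = "\<lambda>i\<in>{..<arity \<Sigma> s}. \<phi> (x i)"
      have y: "?y \<in> {..<arity \<Sigma> s} \<rightarrow>\<^sub>E carrier B" using x \<phi>B by auto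
      have a: "opn A s x \<in> carrier A" using algA s x by (auto simp: is_algebra_def)
      have b: "opn B s ?y \<in> carrier B" using algB s y by (auto simp: is_algebra_def)
      \<comment> \<open>\<open>\<Phi> p\<close> and \<open>snd p\<close> are homomorphisms with
        matching values on the arguments, so the two results form a pair in \<open>R\<close>. As
        \<open>R\<close> is the graph of \<phi>, this is the homomorphism identity.\<close>
      have "\<Phi> p (opn A s x) = snd p (opn B s ?y)" if p: "p \<in> I" for p
      proof -
        have "(\<lambda>i\<in>{..<arity \<Sigma> s}. \<Phi> p (x i)) = (\<lambda>i\<in>{..<arity \<Sigma> s}. snd p (?y i))"
          using x \<phi>p[OF _ p] by (intro restrict_ext) (auto simp: PiE_iff)
        then show ?thesis using homsD(2)[OF hA[OF p] s x] homsD(2)[OF hB[OF p] s y] by simp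
      qed
      then show ?thesis using graph[of "opn A s x" "opn B s ?y"] a b by (simp add: R_def)
    qed
    moreover have "\<phi> \<in> carrier A \<rightarrow>\<^sub>E carrier B" using \<phi>B by (auto simp: \<phi>_def)
    ultimately show ?thesis by (auto simp: homs_def)
  qed
  \<comment> \<open>Closed graph argument: the preimage of a closed \<open>V\<close> is the
    projection of a closed part of \<open>R\<close>, and projecting along the compact factor
    \<open>B\<close> is a closed map.\<close>
  have "continuous_map (topo A) (topo B) \<phi>"
    unfolding continuous_map_closedin
  proof (intro conjI allI impI ballI)
    show "\<phi> \<in> topspace (topo A) \<rightarrow> topspace (topo B)" using \<phi>B tA tB by auto
    fix V assume V: "closedin (topo B) V"
    have "{a \<in> topspace (topo A). \<phi> a \<in> V} = fst ` (R \<inter> topspace (topo A) \<times> V)"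
      using graph tA by force
    moreover have "closedin (prod_topology (topo A) (topo B)) (R \<inter> topspace (topo A) \<times> V)"
      using closedR V by (intro closedin_Int) (auto simp: closedin_prod_Times_iff)
    ultimately show "closedin (topo A) {a \<in> topspace (topo A). \<phi> a \<in> V}"
      using Abstract_Topological_Spaces.closed_map_fst[OF B(2)] by (metis closed_map_def)
  qed
  \<comment> \<open>The same argument for images, projecting along the compact factor
    \<open>A\<close>.\<close>
  moreover have "closed_map (topo A) (topo B) \<phi>"
    unfolding closed_map_def
  proof (intro allI impI)
    fix V assume V: "closedin (topo A) V"
    have "V \<subseteq> carrier A" using closedin_subset[OF V] tA by simp
    then have "\<phi> ` V = snd ` (R \<inter> V \<times> topspace (topo B))"
      using graph \<phi>B tB by force
    moreover have "closedin (prod_topology (topo A) (topo B)) (R \<inter> V \<times> topspace (topo B))"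
      using closedR V by (intro closedin_Int) (auto simp: closedin_prod_Times_iff)
    ultimately show "closedin (topo B) (\<phi> ` V)"
      using Abstract_Topological_Spaces.closed_map_snd[OF A(2)] by (metis closed_map_def)
  qed
  moreover have "\<phi> ` topspace (topo A) = topspace (topo B)"
    using exA graph \<phi>B tA tB by force
  moreover have "inj_on \<phi> (topspace (topo A))"
    using uniqA graph tA by (metis inj_onI)
  ultimately have "homeomorphic_map (topo A) (topo B) \<phi>"
    by (rule bijective_closed_imp_homeomorphic_map)
  then show ?thesis using hom by (auto simp: iso_top_alg_def)
qed


section \<open>Points are separated by finite quotients\<close>

(* Take as test object the congruence of all pairs identified by every map into \<C>: its two
   projections then have to coincide. *)
lemma pro_algebras_separate:
  fixes A :: "('a, 'f) top_alg" and \<C> :: "('c, 'f) alg set"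
  assumes E: "E \<subseteq> equations \<Sigma>" and A: "A \<in> pro_algebras \<Sigma> E \<C>"
    and a: "a \<in> carrier A" "a' \<in> carrier A"
    and eq: "\<And>C h. \<lbrakk>C \<in> \<C>; h \<in> choms \<Sigma> A (discrete_alg C)\<rbrakk> \<Longrightarrow> h a = h a'"
  shows "a = a'"
proof -
  have KA: "A \<in> compact_algebras \<Sigma> E" using A by (simp add: pro_algebras_def)
  then have algA: "is_algebra \<Sigma> A" and tA: "topspace (topo A) = carrier A"
    and compA: "compact_space (topo A)" and hausA: "Hausdorff_space (topo A)"
    by (auto simp: compact_algebras_def topological_algebra_def)
  define P where "P = {(x, y). x \<in> carrier A \<and> y \<in> carrier A \<and>
    (\<forall>C\<in>\<C>. \<forall>h\<in>choms \<Sigma> A (discrete_alg C). h x = h y)}"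
  define B :: "('a \<times> 'a, 'f) top_alg" where "B = \<lparr>carrier = P,
    opn = (\<lambda>s x. (opn A s (\<lambda>i\<in>{..<arity \<Sigma> s}. fst (x i)), opn A s (\<lambda>i\<in>{..<arity \<Sigma> s}. snd (x i)))),
    topo = subtopology (prod_topology (topo A) (topo A)) P\<rparr>"
  have cB: "carrier B = P" by (simp add: B_def)
  have PA: "P \<subseteq> carrier A \<times> carrier A" by (auto simp: P_def)
  have tB: "topspace (topo B) = P" using PA by (auto simp: B_def tA)
  have opB: "opn B s x = (opn A s (\<lambda>i\<in>{..<arity \<Sigma> s}. fst (x i)),
      opn A s (\<lambda>i\<in>{..<arity \<Sigma> s}. snd (x i)))" for s x by (simp add: B_def)
  have coord: "(\<lambda>i\<in>{..<arity \<Sigma> s}. fst (x i)) \<in> {..<arity \<Sigma> s} \<rightarrow>\<^sub>E carrier A"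
      "(\<lambda>i\<in>{..<arity \<Sigma> s}. snd (x i)) \<in> {..<arity \<Sigma> s} \<rightarrow>\<^sub>E carrier A"
    if "x \<in> {..<arity \<Sigma> s} \<rightarrow>\<^sub>E P" for s x
  proof -
    have "x i \<in> carrier A \<times> carrier A" if "i \<in> {..<arity \<Sigma> s}" for i
      using PiE_mem[OF \<open>x \<in> _\<close> that] PA by auto
    then show "(\<lambda>i\<in>{..<arity \<Sigma> s}. fst (x i)) \<in> {..<arity \<Sigma> s} \<rightarrow>\<^sub>E carrier A"
      "(\<lambda>i\<in>{..<arity \<Sigma> s}. snd (x i)) \<in> {..<arity \<Sigma> s} \<rightarrow>\<^sub>E carrier A" by (auto simp: mem_Times_iff)
  qed
  have closed: "opn B s x \<in> P" if s: "s \<in> syms \<Sigma>" and x: "x \<in> {..<arity \<Sigma> s} \<rightarrow>\<^sub>E P" for s x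
  proof -
    have "h (opn A s (\<lambda>i\<in>{..<arity \<Sigma> s}. fst (x i))) = h (opn A s (\<lambda>i\<in>{..<arity \<Sigma> s}. snd (x i)))"
      if C: "C \<in> \<C>" and h: "h \<in> choms \<Sigma> A (discrete_alg C)" for C h
    proof -
      have hh: "h \<in> homs \<Sigma> A C" using h by (simp add: choms_def)
      have "h (fst (x i)) = h (snd (x i))" if "i \<in> {..<arity \<Sigma> s}" for i
        using PiE_mem[OF x that] C h by (auto simp: P_def)
      then have "(\<lambda>i\<in>{..<arity \<Sigma> s}. h ((\<lambda>i\<in>{..<arity \<Sigma> s}. fst (x i)) i)) =
          (\<lambda>i\<in>{..<arity \<Sigma> s}. h ((\<lambda>i\<in>{..<arity \<Sigma> s}. snd (x i)) i))" by (intro restrict_ext) simp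
      then show ?thesis
        using homsD(2)[OF hh s coord(1)[OF x]] homsD(2)[OF hh s coord(2)[OF x]] by simp
    qed
    moreover have "opn A s (\<lambda>i\<in>{..<arity \<Sigma> s}. fst (x i)) \<in> carrier A"
      "opn A s (\<lambda>i\<in>{..<arity \<Sigma> s}. snd (x i)) \<in> carrier A"
      using algA s coord[OF x] unfolding is_algebra_def by blast+
    ultimately show ?thesis by (simp add: opB P_def)
  qed
  have algB: "is_algebra \<Sigma> B" using closed by (simp add: is_algebra_def cB)
  have varB: "B \<in> variety \<Sigma> E"
  proof -
    have "eval B v t = eval B v u" if tu: "(t, u) \<in> E" and v: "range v \<subseteq> P" for t u v
    proof -
      have wf: "wf_trm \<Sigma> t" "wf_trm \<Sigma> u" using E tu by (auto simp: equations_def)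
      have v': "range v \<subseteq> carrier B" using v cB by simp
      \<comment> \<open>Both projections commute with the operations of \<open>B\<close>, so each
        coordinate of a term value is a term value in \<open>A\<close>, where the equation
        holds.\<close>
      have "p (eval B v t) = p (eval B v u)"
        if p: "p = fst \<or> p = snd" for p :: "'a \<times> 'a \<Rightarrow> 'a"
      proof -
        have hom: "p (opn B s x) = opn A s (\<lambda>i\<in>{..<arity \<Sigma> s}. p (x i))" for s x
          using p by (auto simp: opB)
        have "v n \<in> carrier A \<times> carrier A" for n using v PA by auto
        then have "range (p \<circ> v) \<subseteq> carrier A" using p by (auto simp: mem_Times_iff)
        then have "eval A (p \<circ> v) t = eval A (p \<circ> v) u"
          using KA tu by (auto simp: compact_algebras_def variety_def)
        then show ?thesis
          using eval_hom[OF algB v' hom, of t] eval_hom[OF algB v' hom, of u] wf by simp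
      qed
      then show ?thesis by (simp add: prod_eq_iff)
    qed
    with algB show ?thesis by (auto simp: variety_def cB)
  qed
  \<comment> \<open>Compactness of the test object comes from closedness of \<open>P\<close> in the
    compact square of \<open>A\<close>.\<close>
  have closedP: "closedin (prod_topology (topo A) (topo A)) P"
  proof -
    let ?T = "prod_topology (topo A) (topo A)"
    let ?I = "{(C, h). C \<in> \<C> \<and> h \<in> choms \<Sigma> A (discrete_alg C)}"
    let ?K = "\<lambda>p. {x \<in> topspace ?T. (snd p \<circ> fst) x = (snd p \<circ> snd) x}"
    have "closedin ?T (?K p)" if "p \<in> ?I" for p
    proof -
      have c: "continuous_map (topo A) (discrete_topology (carrier (fst p))) (snd p)"
        using that by (auto simp: choms_def)
      show ?thesis
        by (intro closedin_continuous_maps_eq[where Y = "discrete_topology (carrier (fst p))"]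
          continuous_map_compose[OF continuous_map_fst c]
          continuous_map_compose[OF continuous_map_snd c])
          (auto simp: Hausdorff_space_discrete_topology)
    qed
    then have "closedin ?T (\<Inter>(insert (topspace ?T) (?K ` ?I)))"
      by (intro closedin_Inter) (auto simp del: topspace_prod_topology)
    moreover have "\<Inter>(insert (topspace ?T) (?K ` ?I)) = P" by (auto simp: P_def tA)
    ultimately show ?thesis by simp
  qed
  have compB: "compact_space (topo B)"
  proof -
    have "compact_space (prod_topology (topo A) (topo A))"
      using compA by (simp add: compact_space_prod_topology)
    then have "compactin (prod_topology (topo A) (topo A)) P"
      using closedP closedin_compact_space by blast
    then show ?thesis by (simp add: B_def compact_space_subtopology)
  qed
  have hausB: "Hausdorff_space (topo B)"
    using hausA by (auto simp: B_def Hausdorff_space_prod_topology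
        intro!: Hausdorff_space_subtopology)
  have prj: "continuous_map (topo B) (topo A) fst" "continuous_map (topo B) (topo A) snd"
    by (auto simp: B_def intro!: continuous_map_from_subtopology
        continuous_map_fst continuous_map_snd)
  have contB: "continuous_map (product_topology (\<lambda>_. topo B) {..<arity \<Sigma> s}) (topo B) (opn B s)"
    if s: "s \<in> syms \<Sigma>" for s
  proof -
    let ?T = "product_topology (\<lambda>_. topo B) {..<arity \<Sigma> s}"
    let ?TA = "product_topology (\<lambda>_. topo A) {..<arity \<Sigma> s}"
    have cA: "continuous_map ?TA (topo A) (opn A s)"
      using KA s by (auto simp: compact_algebras_def topological_algebra_def)
    have c: "continuous_map ?T (topo A) (\<lambda>x. opn A s (\<lambda>i\<in>{..<arity \<Sigma> s}. p (x i)))"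
      if p: "continuous_map (topo B) (topo A) p" for p
    proof -
      have "continuous_map ?T (topo A) (\<lambda>x. p (x i))" if "i \<in> {..<arity \<Sigma> s}" for i
        using continuous_map_compose[OF continuous_map_product_projection[OF that] p]
        by (simp add: o_def)
      then have "continuous_map ?T ?TA (\<lambda>x. \<lambda>i\<in>{..<arity \<Sigma> s}. p (x i))"
        by (subst continuous_map_componentwise) (auto cong: restrict_cong)
      from continuous_map_compose[OF this cA] show ?thesis by (simp add: o_def)
    qed
    have "continuous_map ?T (prod_topology (topo A) (topo A)) (opn B s)"
      using c[OF prj(1)] c[OF prj(2)] by (simp add: B_def continuous_map_pairwise o_def)
    moreover have "opn B s \<in> topspace ?T \<rightarrow> P"
      using closed[OF s] tB by auto
    ultimately show ?thesis by (simp add: B_def continuous_map_in_subtopology)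
  qed
  have KB: "B \<in> compact_algebras \<Sigma> E"
    unfolding compact_algebras_def topological_algebra_def mem_Collect_eq
    using varB algB tB contB compB hausB cB by (intro conjI ballI) simp_all
  have prjm: "restrict p P \<in> choms \<Sigma> B A" if p: "p = fst \<or> p = snd" for p
  proof -
    have "continuous_map (topo B) (topo A) p" using p prj by auto
    then have "continuous_map (topo B) (topo A) (restrict p P)"
      by (rule continuous_map_eq) (simp add: tB)
    moreover have "restrict p P (opn B s x) = opn A s (\<lambda>i\<in>{..<arity \<Sigma> s}. restrict p P (x i))"
      if s: "s \<in> syms \<Sigma>" and x: "x \<in> {..<arity \<Sigma> s} \<rightarrow>\<^sub>E carrier B" for s x
    proof -
      have "(\<lambda>i\<in>{..<arity \<Sigma> s}. restrict p P (x i)) = (\<lambda>i\<in>{..<arity \<Sigma> s}. p (x i))"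
        using x by (intro restrict_ext) (auto simp: cB PiE_iff)
      then show ?thesis using closed[OF s] x p by (auto simp: opB cB)
    qed
    moreover have "restrict p P \<in> carrier B \<rightarrow>\<^sub>E carrier A" using PA p by (auto simp: cB)
    ultimately show ?thesis by (auto simp: choms_def homs_def)
  qed
  have "compose (carrier B) h (restrict fst P) = compose (carrier B) h (restrict snd P)"
    if "C \<in> \<C>" "h \<in> choms \<Sigma> A (discrete_alg C)" for C h
    using that by (auto simp: compose_def cB P_def intro!: restrict_ext)
  then have same: "restrict fst P = restrict snd P"
    using A KB prjm[of fst] prjm[of snd] unfolding pro_algebras_def by blast
  have "(a, a') \<in> P" using a eq by (simp add: P_def)
  with fun_cong[OF same, of "(a, a')"] show ?thesis by (simp add: restrict_def)
qed

section \<open>Transport along isomorphisms\<close>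

text \<open>Maps on \<open>B\<close> that agree after precomposition with the surjective
  \<open>f\<close> are equal, so precomposition is an injection.\<close>

lemma choms_lepoll:
  assumes "is_algebra \<Sigma> A" "topspace (topo A) = carrier A"
    and f: "f \<in> choms \<Sigma> A B" "f ` carrier A = carrier B"
  shows "choms \<Sigma> B X \<lesssim> choms \<Sigma> A X"
proof -
  have "inj_on (\<lambda>h. compose (carrier A) h f) (choms \<Sigma> B X)"
  proof (rule inj_onI)
    fix g h assume gh: "g \<in> choms \<Sigma> B X" "h \<in> choms \<Sigma> B X"
      and eq: "compose (carrier A) g f = compose (carrier A) h f"
    have "g (f a) = h (f a)" if "a \<in> carrier A" for a
      using fun_cong[OF eq, of a] that by (simp add: compose_def)
    then have "g b = h b" if "b \<in> carrier B" for b using f(2) that by (metis imageE)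
    then show "g = h" using gh by (intro PiE_ext[of _ "carrier B" "\<lambda>_. carrier X"])
        (auto simp: choms_def homs_def)
  qed
  moreover have "(\<lambda>h. compose (carrier A) h f) ` choms \<Sigma> B X \<subseteq> choms \<Sigma> A X"
    using choms_compose[OF assms(1,2) f(1)] by auto
  ultimately show ?thesis by (auto simp: lepoll_def)
qed

text \<open>The isomorphism and its inverse are both surjective morphisms, so
  \<open>choms_lepoll\<close> applies in either direction and Schroeder-Bernstein concludes.\<close>

lemma iso_top_alg_choms_eqpoll:
  assumes A: "is_algebra \<Sigma> A" "topspace (topo A) = carrier A"
    and B: "is_algebra \<Sigma> B" "topspace (topo B) = carrier B"
    and iso: "iso_top_alg \<Sigma> A B"
  shows "choms \<Sigma> A X \<approx> choms \<Sigma> B X"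
proof (rule lepoll_antisym)
  obtain f where f: "f \<in> homs \<Sigma> A B" and hf: "homeomorphic_map (topo A) (topo B) f"
    using iso by (auto simp: iso_top_alg_def)
  have im: "f ` carrier A = carrier B" and inj: "inj_on f (carrier A)"
    using hf A(2) B(2) by (auto simp: homeomorphic_eq_everything_map)
  have "f \<in> choms \<Sigma> A B" using f hf by (simp add: choms_def homeomorphic_imp_continuous_map)
  then show "choms \<Sigma> B X \<lesssim> choms \<Sigma> A X" using im by (rule choms_lepoll[OF A])
  \<comment> \<open>The inverse of \<open>f\<close> is written as the lift of the identity of
    \<open>B\<close> along \<open>f\<close>, so that \<open>homs_factor\<close> shows it to be a
    homomorphism.\<close>
  let ?g = "compose (carrier B) (inv_into (carrier A) f) (\<lambda>b\<in>carrier B. b)"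
  have inv: "inv_into (carrier A) f b \<in> carrier A" "f (inv_into (carrier A) f b) = b"
    if "b \<in> carrier B" for b
    using im that by (auto simp: inv_into_into f_inv_into_f)
  have "(\<lambda>b\<in>carrier B. b) \<in> homs \<Sigma> B B"
  proof -
    have "opn B s x = opn B s (\<lambda>i\<in>{..<arity \<Sigma> s}. (\<lambda>b\<in>carrier B. b) (x i))"
      if "x \<in> {..<arity \<Sigma> s} \<rightarrow>\<^sub>E carrier B" for s x
      using that by (intro arg_cong[where f = "opn B s"] extensionalityI[of _ "{..<arity \<Sigma> s}"])
        (auto simp: PiE_def)
    then show ?thesis using B(1) by (auto simp: homs_def is_algebra_def)
  qed
  then have "?g \<in> homs \<Sigma> B A" using im by (intro homs_factor[OF B(1) A(1) _ f inj]) auto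
  moreover have "continuous_map (topo B) (topo A) ?g"
  proof -
    obtain g where g: "homeomorphic_maps (topo A) (topo B) f g"
      using hf homeomorphic_map_maps by blast
    then have cg: "continuous_map (topo B) (topo A) g" by (simp add: homeomorphic_maps_def)
    have "g b = ?g b" if b: "b \<in> carrier B" for b
    proof -
      have "g (f (inv_into (carrier A) f b)) = inv_into (carrier A) f b"
        using g inv(1)[OF b] A(2) by (simp add: homeomorphic_maps_def)
      then show ?thesis using inv(2)[OF b] b by (simp add: compose_def)
    qed
    then show ?thesis using B(2) by (intro continuous_map_eq[OF cg]) simp
  qed
  moreover have "?g ` carrier B = carrier A"
    using inv_into_image_cancel[OF inj subset_refl] im by (simp add: compose_def)
  ultimately show "choms \<Sigma> A X \<lesssim> choms \<Sigma> B X"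
    by (intro choms_lepoll[OF B]) (auto simp: choms_def)
qed

section \<open>Both directions of the equivalence\<close>

theorem theorem6p3:
  fixes \<Sigma> :: "'f signature" and E :: "('f trm \<times> 'f trm) set"
    and \<C> :: "('c, 'f) alg set"
    and A :: "('a, 'f) top_alg" and B :: "('b, 'f) top_alg"
  assumes "E \<subseteq> equations \<Sigma>"
    and "\<C> \<subseteq> variety_fin \<Sigma> E"
    and "closed_subalgebras \<Sigma> \<C>"
    and "closed_finite_products \<Sigma> \<C>"
    and "A \<in> pro_algebras \<Sigma> E \<C>" and "topologically_fg \<Sigma> A"
    and "B \<in> pro_algebras \<Sigma> E \<C>" and "topologically_fg \<Sigma> B"
  shows "iso_top_alg \<Sigma> A B \<longleftrightarrow>
    (\<forall>C\<in>\<C>. choms \<Sigma> A (discrete_alg C) \<approx> choms \<Sigma> B (discrete_alg C))"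
proof -
  have topA: "topological_algebra \<Sigma> A" "compact_space (topo A)"
    and topB: "topological_algebra \<Sigma> B" "compact_space (topo B)"
    using assms(5,7) by (auto simp: pro_algebras_def compact_algebras_def)
  then have A: "is_algebra \<Sigma> A" "topspace (topo A) = carrier A"
    and B: "is_algebra \<Sigma> B" "topspace (topo B) = carrier B"
    by (auto simp: topological_algebra_def)
  have alg: "is_algebra \<Sigma> C" and fin: "finite (carrier C)" if "C \<in> \<C>" for C
    using that assms(2) by (auto simp: variety_fin_def variety_def)
  note finA = finite_choms[OF topA(1) assms(6) fin]
    and finB = finite_choms[OF topB(1) assms(8) fin]
  show ?thesis
  proof
    assume "iso_top_alg \<Sigma> A B"
    then show "\<forall>C\<in>\<C>. choms \<Sigma> A (discrete_alg C) \<approx> choms \<Sigma> B (discrete_alg C)"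
      by (intro ballI iso_top_alg_choms_eqpoll[OF A B])
  next
    assume "\<forall>C\<in>\<C>. choms \<Sigma> A (discrete_alg C) \<approx> choms \<Sigma> B (discrete_alg C)"
    \<comment> \<open>Finite generation makes these sets finite, so equipollence amounts to equality
      of cardinalities.\<close>
    then have eq: "card (choms \<Sigma> A (discrete_alg C)) = card (choms \<Sigma> B (discrete_alg C))"
      if "C \<in> \<C>" for C
      using that finA finB eqpoll_iff_card by blast
    have surj: "surj_choms \<Sigma> A D \<noteq> {}" if D: "D \<in> \<C>" and ne: "surj_choms \<Sigma> B D \<noteq> {}" for D
    proof -
      have "card (surj_choms \<Sigma> A D) = card (surj_choms \<Sigma> B D)"
        using card_surj_choms_eq[OF A B assms(3) alg fin finA finB eq D] .
      moreover have "finite (surj_choms \<Sigma> B D)" using finB[OF D] by (simp add: surj_choms_def)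
      ultimately show ?thesis using ne by auto
    qed
    define I where "I = {(C, h). C \<in> \<C> \<and> h \<in> choms \<Sigma> B (discrete_alg C)}"
    obtain \<Phi> where \<Phi>: "\<forall>p\<in>I. \<Phi> p \<in> choms \<Sigma> A (discrete_alg (fst p))"
      and compat: "\<forall>F. finite F \<longrightarrow> F \<subseteq> I \<longrightarrow>
        (\<lambda>a. \<lambda>p\<in>F. \<Phi> p a) ` carrier A = (\<lambda>b. \<lambda>p\<in>F. snd p b) ` carrier B"
      by (rule compatible_family[OF A B assms(3,4) alg finA surj, folded I_def])
    have onto: "\<exists>h\<in>choms \<Sigma> B (discrete_alg C). \<Phi> (C, h) = g"
      if C: "C \<in> \<C>" and g: "g \<in> choms \<Sigma> A (discrete_alg C)" for C g
    proof -
      let ?HA = "choms \<Sigma> A (discrete_alg C)" and ?HB = "choms \<Sigma> B (discrete_alg C)"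
      have "inj_on (\<lambda>h. \<Phi> (C, h)) ?HB"
      proof (rule inj_onI)
        fix h h' assume h: "h \<in> ?HB" "h' \<in> ?HB" and same: "\<Phi> (C, h) = \<Phi> (C, h')"
        \<comment> \<open>If the two \<open>\<Phi>\<close>-images coincide, the joint image of
          \<open>A\<close> lies in the diagonal, hence so does that of \<open>B\<close> under
          \<open>h\<close> and \<open>h'\<close>.\<close>
        let ?F = "{(C, h), (C, h')}"
        have F: "finite ?F" "?F \<subseteq> I" using C h by (auto simp: I_def)
        have "h b = h' b" if b: "b \<in> carrier B" for b
        proof -
          have "(\<lambda>p\<in>?F. snd p b) \<in> (\<lambda>a. \<lambda>p\<in>?F. \<Phi> p a) ` carrier A"
            using compat F b by blast
          then obtain a where a: "(\<lambda>p\<in>?F. snd p b) = (\<lambda>p\<in>?F. \<Phi> p a)" by blast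
          show ?thesis
            using fun_cong[OF a, of "(C, h)"] fun_cong[OF a, of "(C, h')"] same by simp
        qed
        then show "h = h'"
          using h by (intro PiE_ext[of _ "carrier B" "\<lambda>_. carrier C"])
            (auto simp: choms_def homs_def)
      qed
      moreover have "(\<lambda>h. \<Phi> (C, h)) ` ?HB \<subseteq> ?HA" using \<Phi> C by (auto simp: I_def)
      ultimately have "(\<lambda>h. \<Phi> (C, h)) ` ?HB = ?HA"
        using eq[OF C] finA[OF C] by (metis card_image card_subset_eq)
      then show ?thesis using g by (metis imageE)
    qed
    show "iso_top_alg \<Sigma> A B"
    proof (rule iso_from_compatible_family[OF topA topB _ _ I_def bspec[OF \<Phi>]
        compat[rule_format] onto])
      show "a = a'" if "a \<in> carrier A" "a' \<in> carrier A"
          "\<And>C h. \<lbrakk>C \<in> \<C>; h \<in> choms \<Sigma> A (discrete_alg C)\<rbrakk> \<Longrightarrow> h a = h a'" for a a'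
        using that by (rule pro_algebras_separate[OF assms(1,5)])
      show "b = b'" if "b \<in> carrier B" "b' \<in> carrier B"
          "\<And>C h. \<lbrakk>C \<in> \<C>; h \<in> choms \<Sigma> B (discrete_alg C)\<rbrakk> \<Longrightarrow> h b = h b'" for b b'
        using that by (rule pro_algebras_separate[OF assms(1,7)])
    qed
  qed
qed

end
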